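(* Let $(\Lambda V,d)$ be an elliptic minimal algebra over $\mathbb{Q}$ with differential of homogeneous-length $l$, where $l\ge 2$ (that is, $d(V)\subseteq\Lambda^lV$), and suppose that $\ker\big(d\colon V^{\mathrm{odd}}\to\Lambda V\big)$ is non-zero. Let $$e=\mathrm{cat}_0(\Lambda V)=\mathrm{e}_0(\Lambda V)=\dim V^{\mathrm{odd}}+(l-2)\dim V^{\mathrm{even}}.$$ Then $\dim\big(H^*_k(\Lambda V)\big)\ge 2$ for each $k=1,\ldots,e-1$.
   Context: A minimal algebra is a free graded commutative algebra $\Lambda V$ over $\mathbb{Q}$ on a finite-type graded vector space $V$ concentrated in degrees $\ge 2$ (simply connected), with a differential $d$ (a derivation of degree $+1$ with $d^2=0$) that is decomposable: $d(V)\subseteq\Lambda^{\ge 2}V$. Here $\Lambda^kV$ is the span of products of exactly $k$ elements of $V$ (word-length $k$), $\Lambda^0V=\mathbb{Q}$, and $\Lambda^{\ge k}V=\bigoplus_{j\ge k}\Lambda^jV$. $\Lambda V$ is elliptic if both $V$ and $H^*(\Lambda V)$ are finite-dimensional. $V^{\mathrm{odd}}$ and $V^{\mathrm{even}}$ denote the odd-degree and even-degree parts of $V$. Toomer invariant: for $n\ge 1$ let $p_n\colon\Lambda V\to\Lambda V/\Lambda^{\ge n+1}V$ be the projection of differential graded algebras. Then $\mathrm{e}_0(\Lambda V)$ is the smallest $n$ such that $p_n$ induces an injection on cohomology ($\infty$ if there is none). $\mathrm{cat}_0(\Lambda V)$ is the rational category, i.e. the (normalized) Lusternik–Schnirelmann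 category of the simply connected rational space whose Sullivan minimal model is $\Lambda V$. Under the ellipticity and homogeneous-length hypotheses, the equalities $\mathrm{cat}_0(\Lambda V)=\mathrm{e}_0(\Lambda V)=\dim V^{\mathrm{odd}}+(l-2)\dim V^{\mathrm{even}}$ are known to hold. Second grading: if $d(V)\subseteq\Lambda^lV$, then $d(\Lambda^kV)\subseteq\Lambda^{k+l-1}V$, so cohomology is bigraded: $H^i_k(\Lambda V)$ is the subspace of $H^i(\Lambda V)$ of classes represented by cocycles in $\Lambda^kV$, and $H^*(\Lambda V)=\bigoplus_{k\ge0}H^*_k(\Lambda V)$, with $H^*_k(\Lambda V)=\bigoplus_i H^i_k(\Lambda V)$. *)

theory Defs
  imports Complex_Main "HOL-Library.Poly_Mapping" "HOL-Library.Extended_Nat"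
begin

text \<open>
  Let \<open>V\<close> be a graded rational vector space of finite type with a homogeneous basis
  \<open>X\<close>, the element \<open>x\<close> of \<open>X\<close> having degree \<open>deg x\<close>.  As \<open>V\<close> is of finite type its basis is
  countable, so that \<open>X\<close> may be taken to be a set of natural numbers.  The free graded
  commutative algebra \<open>\<Lambda>V\<close> has as basis the ordered monomials: exponent vectors
  \<open>m\<close> supported on \<open>X\<close> in which the generators of odd degree have exponent at most 1;
  \<open>m\<close> stands for the product of the powers of the generators taken in increasing order.
  An element of \<open>\<Lambda>V\<close> is a finitely supported rational function on these monomials.
  The multiplication that \<open>HOL-Library.Poly_Mapping\<close> puts on the type \<open>elt\<close> is that of
  ordinary commutative polynomials; it is not used here (see \<open>gmult\<close>).
\<close>

type_synonym mono = "nat \<Rightarrow>\<^sub>0 nat"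
type_synonym elt = "mono \<Rightarrow>\<^sub>0 rat"

definition qscale :: "rat \<Rightarrow> elt \<Rightarrow> elt" where
  "qscale c p = Poly_Mapping.map ((*) c) p"

lemma lookup_qscale: "Poly_Mapping.lookup (qscale c p) m = c * Poly_Mapping.lookup p m"
  by (simp add: qscale_def Poly_Mapping.map.rep_eq when_def)

global_interpretation elt: vector_space qscale
  by unfold_locales (auto intro!: poly_mapping_eqI simp: lookup_qscale lookup_add algebra_simps)

definition word_length :: "mono \<Rightarrow> nat" where
  "word_length m = (\<Sum>x\<in>Poly_Mapping.keys m. Poly_Mapping.lookup m x)"

definition mono_degree :: "(nat \<Rightarrow> nat) \<Rightarrow> mono \<Rightarrow> nat" where
  "mono_degree deg m = (\<Sum>x\<in>Poly_Mapping.keys m. Poly_Mapping.lookup m x * deg x)"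

text \<open>
  The Koszul sign of the product of two ordered monomials: it is 0 if they share a generator of
  odd degree, and otherwise it is the sign of the permutation that sorts the odd
  generators of the concatenated word.
\<close>

definition koszul_sign :: "(nat \<Rightarrow> nat) \<Rightarrow> mono \<Rightarrow> mono \<Rightarrow> rat" where
  "koszul_sign deg m n =
     (if \<exists>x. odd (deg x) \<and> x \<in> Poly_Mapping.keys m \<and> x \<in> Poly_Mapping.keys n then 0
      else (- 1) ^ card {(x, y). x \<in> Poly_Mapping.keys m \<and> y \<in> Poly_Mapping.keys n \<and>
                                 odd (deg x) \<and> odd (deg y) \<and> y < x})"

definition gmult :: "(nat \<Rightarrow> nat) \<Rightarrow> elt \<Rightarrow> elt \<Rightarrow> elt" where
  "gmult deg p q =
     (\<Sum>m\<in>Poly_Mapping.keys p. \<Sum>n\<in>Poly_Mapping.keys q.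
        Poly_Mapping.single (m + n)
          (koszul_sign deg m n * Poly_Mapping.lookup p m * Poly_Mapping.lookup q n))"

definition basis_monos :: "nat set \<Rightarrow> (nat \<Rightarrow> nat) \<Rightarrow> mono set" where
  "basis_monos X deg = {m. Poly_Mapping.keys m \<subseteq> X \<and>
                     (\<forall>x\<in>Poly_Mapping.keys m. odd (deg x) \<longrightarrow> Poly_Mapping.lookup m x = 1)}"

definition Lam :: "nat set \<Rightarrow> (nat \<Rightarrow> nat) \<Rightarrow> elt set" where
  "Lam X deg = {p. Poly_Mapping.keys p \<subseteq> basis_monos X deg}"

definition Lam_deg :: "nat set \<Rightarrow> (nat \<Rightarrow> nat) \<Rightarrow> nat \<Rightarrow> elt set" where
  "Lam_deg X deg i = {p \<in> Lam X deg. \<forall>m\<in>Poly_Mapping.keys p. mono_degree deg m = i}"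

definition Lam_word :: "nat set \<Rightarrow> (nat \<Rightarrow> nat) \<Rightarrow> nat \<Rightarrow> elt set" where
  "Lam_word X deg k = {p \<in> Lam X deg. \<forall>m\<in>Poly_Mapping.keys p. word_length m = k}"

definition Lam_word_ge :: "nat set \<Rightarrow> (nat \<Rightarrow> nat) \<Rightarrow> nat \<Rightarrow> elt set" where
  "Lam_word_ge X deg k = {p \<in> Lam X deg. \<forall>m\<in>Poly_Mapping.keys p. k \<le> word_length m}"

abbreviation gens :: "nat set \<Rightarrow> (nat \<Rightarrow> nat) \<Rightarrow> elt set" where
  "gens X deg \<equiv> Lam_word X deg 1"

definition gens_odd :: "nat set \<Rightarrow> (nat \<Rightarrow> nat) \<Rightarrow> elt set" where
  "gens_odd X deg = {v \<in> gens X deg. \<forall>m\<in>Poly_Mapping.keys v. odd (mono_degree deg m)}"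

definition gens_even :: "nat set \<Rightarrow> (nat \<Rightarrow> nat) \<Rightarrow> elt set" where
  "gens_even X deg = {v \<in> gens X deg. \<forall>m\<in>Poly_Mapping.keys v. even (mono_degree deg m)}"

text \<open>Only the values of \<open>d\<close> on \<open>Lam X deg\<close> are relevant.\<close>

locale minimal_algebra =
  fixes X :: "nat set" and deg :: "nat \<Rightarrow> nat" and d :: "elt \<Rightarrow> elt"
  assumes simply_connected: "x \<in> X \<Longrightarrow> 2 \<le> deg x"
    and finite_type: "finite {x \<in> X. deg x = i}"
    and d_add: "a \<in> Lam X deg \<Longrightarrow> b \<in> Lam X deg \<Longrightarrow> d (a + b) = d a + d b"
    and d_scale: "a \<in> Lam X deg \<Longrightarrow> d (qscale c a) = qscale c (d a)"
    and d_degree: "a \<in> Lam_deg X deg i \<Longrightarrow> d a \<in> Lam_deg X deg (i + 1)"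
    and d_derivation: "a \<in> Lam_deg X deg i \<Longrightarrow> b \<in> Lam X deg \<Longrightarrow>
          d (gmult deg a b) = gmult deg (d a) b + qscale ((- 1) ^ i) (gmult deg a (d b))"
    and d_squared: "a \<in> Lam X deg \<Longrightarrow> d (d a) = 0"
    and d_decomposable: "v \<in> gens X deg \<Longrightarrow> d v \<in> Lam_word_ge X deg 2"

definition cocycles :: "nat set \<Rightarrow> (nat \<Rightarrow> nat) \<Rightarrow> (elt \<Rightarrow> elt) \<Rightarrow> elt set" where
  "cocycles X deg d = {a \<in> Lam X deg. d a = 0}"

definition coboundaries :: "nat set \<Rightarrow> (nat \<Rightarrow> nat) \<Rightarrow> (elt \<Rightarrow> elt) \<Rightarrow> elt set" where
  "coboundaries X deg d = d ` Lam X deg"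

text \<open>
  For subspaces \<open>U\<close> and \<open>B\<close>, the dimension of \<open>(U + B)/B\<close>, that is, of the space of classes
  modulo \<open>B\<close> that have a representative in \<open>U\<close>: the supremum of the sizes of the
  finite sets of vectors of \<open>U\<close> that are linearly independent modulo \<open>B\<close>.
\<close>

definition dim_mod :: "elt set \<Rightarrow> elt set \<Rightarrow> enat" where
  "dim_mod B U =
     (SUP S\<in>{S. finite S \<and> S \<subseteq> U \<and>
               (\<forall>c. (\<Sum>s\<in>S. qscale (c s) s) \<in> B \<longrightarrow> (\<forall>s\<in>S. c s = 0))}. enat (card S))"

definition dim_cohomology :: "nat set \<Rightarrow> (nat \<Rightarrow> nat) \<Rightarrow> (elt \<Rightarrow> elt) \<Rightarrow> enat" where
  "dim_cohomology X deg d = dim_mod (coboundaries X deg d) (cocycles X deg d)"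

text \<open>
  The dimension of \<open>H\<^sup>*\<^sub>k\<close>, the space of the cohomology classes represented by cocycles of
  word-length \<open>k\<close>.
\<close>

definition dim_cohomology_word ::
    "nat set \<Rightarrow> (nat \<Rightarrow> nat) \<Rightarrow> (elt \<Rightarrow> elt) \<Rightarrow> nat \<Rightarrow> enat" where
  "dim_cohomology_word X deg d k =
     dim_mod (coboundaries X deg d) (cocycles X deg d \<inter> Lam_word X deg k)"

definition elliptic :: "nat set \<Rightarrow> (nat \<Rightarrow> nat) \<Rightarrow> (elt \<Rightarrow> elt) \<Rightarrow> bool" where
  "elliptic X deg d \<longleftrightarrow>
     (\<exists>S. finite S \<and> gens X deg = elt.span S) \<and> dim_cohomology X deg d < \<infinity>"

definition homogeneous_length ::
    "nat set \<Rightarrow> (nat \<Rightarrow> nat) \<Rightarrow> (elt \<Rightarrow> elt) \<Rightarrow> nat \<Rightarrow> bool" where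
  "homogeneous_length X deg d l \<longleftrightarrow> d ` gens X deg \<subseteq> Lam_word X deg l"

text \<open>
  The map induced on cohomology by \<open>p\<^sub>n : \<Lambda>V \<rightarrow> \<Lambda>V/\<Lambda>\<^sup>\<ge>\<^sup>n\<^sup>+\<^sup>1V\<close> is injective: a cocycle of \<open>\<Lambda>V\<close> that
  becomes a coboundary in the quotient is a coboundary in \<open>\<Lambda>V\<close>.
\<close>

definition proj_injective ::
    "nat set \<Rightarrow> (nat \<Rightarrow> nat) \<Rightarrow> (elt \<Rightarrow> elt) \<Rightarrow> nat \<Rightarrow> bool" where
  "proj_injective X deg d n \<longleftrightarrow>
     (\<forall>z\<in>cocycles X deg d.
        (\<exists>b\<in>Lam X deg. z - d b \<in> Lam_word_ge X deg (n + 1)) \<longrightarrow> z \<in> coboundaries X deg d)"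

definition toomer :: "nat set \<Rightarrow> (nat \<Rightarrow> nat) \<Rightarrow> (elt \<Rightarrow> elt) \<Rightarrow> enat" where
  "toomer X deg d = Inf {enat n | n. 1 \<le> n \<and> proj_injective X deg d n}"

end

theory Submission
  imports Defs
begin

text \<open>
  The generators are removed one at a time: first the odd cocycle \<open>v\<close>, then the remaining ones
  in order of increasing degree, each of which is a cocycle modulo the previous ones because
  \<open>d\<close> is decomposable.  For a cocycle generator \<open>v\<close> of degree \<open>n\<close>, multiplication by \<open>v\<close> gives
  a short exact sequence \<open>0 \<rightarrow> B \<rightarrow> \<Lambda>V \<rightarrow> \<Lambda>V/(v) \<rightarrow> 0\<close>, where \<open>B\<close> is \<open>\<Lambda>V/(v)\<close> if \<open>n\<close> is odd and
  \<open>\<Lambda>V\<close> if \<open>n\<close> is even.  As the connecting maps lower the degree by \<open>n - 1\<close> and raise the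
  word-length by \<open>l - 2\<close>, it is enough to know which of the spaces \<open>H\<^sup>i\<^sub>k\<close> vanish: by induction
  on the number of generators the maximal word-length \<open>e\<close> and the maximal degree occur together,
  and the least and the greatest degree of \<open>H\<^sub>k\<close> are nondecreasing for \<open>0 \<le> k \<le> e\<close>.  Hence, when
  \<open>v\<close> is odd, a class of least degree in \<open>H\<^sub>k(\<Lambda>V/(v))\<close> lifts to \<open>\<Lambda>V\<close>, and the product of \<open>v\<close>
  with a class of greatest degree in \<open>H\<^sub>k\<^sub>-\<^sub>1(\<Lambda>V/(v))\<close> does not vanish in \<open>H(\<Lambda>V)\<close>.
\<close>

section \<open>Bigraded complexes\<close>

text \<open>Only non-vanishing of cohomology is used, so no quotient space is formed. Integer
  indices keep the shifts \<open>i - 1\<close> and \<open>k - s\<close> from being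
  truncated.\<close>

definition nonzero_coh ::
    "(int \<Rightarrow> int \<Rightarrow> 'a::ab_group_add set) \<Rightarrow> ('a \<Rightarrow> 'a) \<Rightarrow> int \<Rightarrow> int \<Rightarrow> int \<Rightarrow> bool" where
  "nonzero_coh C d s i k \<longleftrightarrow> (\<exists>z\<in>C i k. d z = 0 \<and> z \<notin> d ` C (i - 1) (k - s))"

locale bigraded_complex =
  fixes C :: "int \<Rightarrow> int \<Rightarrow> 'a::ab_group_add set" and d :: "'a \<Rightarrow> 'a" and s :: int
  assumes zero_mem: "0 \<in> C i k"
    and diff_mem: "a \<in> C i k \<Longrightarrow> b \<in> C i k \<Longrightarrow> a - b \<in> C i k"
    and d_mem: "a \<in> C i k \<Longrightarrow> d a \<in> C (i + 1) (k + s)"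
    and d_diff: "a \<in> C i k \<Longrightarrow> b \<in> C i k \<Longrightarrow> d (a - b) = d a - d b"
    and d_d: "a \<in> C i k \<Longrightarrow> d (d a) = 0"
begin

lemma d_zero: "d 0 = 0"
  using d_diff[OF zero_mem zero_mem] by simp

lemma add_mem: "a \<in> C i k \<Longrightarrow> b \<in> C i k \<Longrightarrow> a + b \<in> C i k"
  using diff_mem[of a i k "0 - b"] diff_mem[OF zero_mem, of b i k] by simp

lemma d_add: "a \<in> C i k \<Longrightarrow> b \<in> C i k \<Longrightarrow> d (a + b) = d a + d b"
  using d_diff[of a i k "0 - b"] d_diff[OF zero_mem, of b i k] diff_mem[OF zero_mem, of b i k]
  by (simp add: d_zero)

lemma d_mem': "a \<in> C (i - 1) (k - s) \<Longrightarrow> d a \<in> C i k"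
  using d_mem[of a "i - 1" "k - s"] by simp

end

section \<open>The long exact sequence of 0 -> B -> A -> Q -> 0\<close>

locale short_exact_sequence =
  A: bigraded_complex CA dA s + B: bigraded_complex CB dB s + Q: bigraded_complex CQ dQ s
  for CA CB CQ :: "int \<Rightarrow> int \<Rightarrow> 'a::ab_group_add set" and dA dB dQ s +
  fixes j p :: "'a \<Rightarrow> 'a" and n :: int
  assumes j_mem: "b \<in> CB i k \<Longrightarrow> j b \<in> CA (i + n) (k + 1)"
    and j_diff: "b \<in> CB i k \<Longrightarrow> b' \<in> CB i k \<Longrightarrow> j (b - b') = j b - j b'"
    and j_inj: "b \<in> CB i k \<Longrightarrow> j b = 0 \<Longrightarrow> b = 0"
    and j_d: "b \<in> CB i k \<Longrightarrow> dA (j b) = j (dB b)"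
    and p_diff: "a \<in> CA i k \<Longrightarrow> a' \<in> CA i k \<Longrightarrow> p (a - a') = p a - p a'"
    and p_surj: "c \<in> CQ i k \<Longrightarrow> \<exists>a\<in>CA i k. p a = c"
    and p_mem: "a \<in> CA i k \<Longrightarrow> p a \<in> CQ i k"
    and p_d: "a \<in> CA i k \<Longrightarrow> p (dA a) = dQ (p a)"
    and p_j: "b \<in> CB i k \<Longrightarrow> p (j b) = 0"
    and p_ker: "a \<in> CA i k \<Longrightarrow> p a = 0 \<Longrightarrow> \<exists>b\<in>CB (i - n) (k - 1). a = j b"
begin

lemma p_zero: "p 0 = 0"
  using p_diff[OF A.zero_mem A.zero_mem] by simp

lemma j_zero: "j 0 = 0"
  using j_diff[OF B.zero_mem B.zero_mem] by simp

lemma j_mem': "b \<in> CB (i - n) (k - 1) \<Longrightarrow> j b \<in> CA i k"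
  using j_mem[of b "i - n" "k - 1"] by simp

lemma j_cancel: "b \<in> CB i k \<Longrightarrow> b' \<in> CB i k \<Longrightarrow> j b = j b' \<Longrightarrow> b = b'"
  using j_inj[OF B.diff_mem, of b i k b'] j_diff[of b i k b'] by simp

text \<open>Exactness at H(A): if the class of \<open>p z\<close> vanishes, subtracting a coboundary
  moves \<open>z\<close> into the image of \<open>j\<close>. Its preimage is not a coboundary of B
  because \<open>z\<close> is not one of A.\<close>

lemma exact_middle:
  assumes "nonzero_coh CA dA s i k"
  shows "nonzero_coh CB dB s (i - n) (k - 1) \<or> nonzero_coh CQ dQ s i k"
proof (rule disjCI)
  assume nQ: "\<not> nonzero_coh CQ dQ s i k"
  obtain z where z: "z \<in> CA i k" "dA z = 0" "z \<notin> dA ` CA (i - 1) (k - s)"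
    using assms by (auto simp: nonzero_coh_def)
  have "dQ (p z) = 0" using p_d[OF z(1)] z(2) p_zero by simp
  then obtain c where c: "c \<in> CQ (i - 1) (k - s)" "p z = dQ c"
    using nQ p_mem[OF z(1)] by (auto simp: nonzero_coh_def)
  obtain a where a: "a \<in> CA (i - 1) (k - s)" "p a = c" using p_surj[OF c(1)] by auto
  have da: "dA a \<in> CA i k" by (rule A.d_mem'[OF a(1)])
  have "p (z - dA a) = 0" using p_diff[OF z(1) da] p_d[OF a(1)] a c by simp
  then obtain b where b: "b \<in> CB (i - n) (k - 1)" "z - dA a = j b"
    using p_ker[OF A.diff_mem[OF z(1) da]] by auto
  have "j (dB b) = 0"
    using j_d[OF b(1)] b(2) A.d_diff[OF z(1) da] z(2) A.d_d[OF a(1)] by simp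
  then have "dB b = 0" using j_inj[OF B.d_mem[OF b(1)]] by simp
  moreover have "b \<notin> dB ` CB (i - n - 1) (k - 1 - s)"
  proof
    assume "b \<in> dB ` CB (i - n - 1) (k - 1 - s)"
    then obtain b' where b': "b' \<in> CB (i - n - 1) (k - 1 - s)" "b = dB b'" by auto
    have jb': "j b' \<in> CA (i - 1) (k - s)"
      using j_mem[OF b'(1)] by (simp add: algebra_simps)
    have "z = dA a + dA (j b')" using b(2) b'(2) j_d[OF b'(1)] by (simp add: algebra_simps)
    then have "z = dA (a + j b')" using A.d_add[OF a(1) jb'] by simp
    then show False using z(3) A.add_mem[OF a(1) jb'] by auto
  qed
  ultimately show "nonzero_coh CB dB s (i - n) (k - 1)"
    using b(1) by (auto simp: nonzero_coh_def)
qed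

text \<open>Exactness at H(Q): the connecting map sends the class of \<open>c\<close> to that of the
  \<open>b\<close> with \<open>dA a = j b\<close>. If the latter is zero, the lift \<open>a\<close>
  can be corrected within the image of \<open>j\<close> to a cocycle. The cocycle is returned
  because its image under \<open>p\<close> is needed later.\<close>

lemma exact_quotient:
  assumes "nonzero_coh CQ dQ s i k" "\<not> nonzero_coh CB dB s (i + 1 - n) (k + s - 1)"
  obtains z where "z \<in> CA i k" "dA z = 0" "p z \<notin> dQ ` CQ (i - 1) (k - s)"
proof -
  obtain c where c: "c \<in> CQ i k" "dQ c = 0" "c \<notin> dQ ` CQ (i - 1) (k - s)"
    using assms by (auto simp: nonzero_coh_def)
  obtain a where a: "a \<in> CA i k" "p a = c" using p_surj[OF c(1)] by auto
  obtain b where b: "b \<in> CB (i + 1 - n) (k + s - 1)" "dA a = j b"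
    using p_ker[OF A.d_mem[OF a(1)]] p_d[OF a(1)] a(2) c(2) by auto
  have "j (dB b) = 0" using j_d[OF b(1)] b(2) A.d_d[OF a(1)] by simp
  then have "dB b = 0" using j_inj[OF B.d_mem[OF b(1)]] by simp
  then obtain b' where b': "b' \<in> CB (i + 1 - n - 1) (k + s - 1 - s)" "b = dB b'"
    using assms(2) b(1) by (auto simp: nonzero_coh_def)
  have b'1: "b' \<in> CB (i - n) (k - 1)" using b'(1) by (simp add: algebra_simps)
  have jb': "j b' \<in> CA i k" by (rule j_mem'[OF b'1])
  show ?thesis
  proof
    show "a - j b' \<in> CA i k" by (rule A.diff_mem[OF a(1) jb'])
    show "dA (a - j b') = 0" using A.d_diff[OF a(1) jb'] j_d[OF b'1] b(2) b'(2) by simp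
    show "p (a - j b') \<notin> dQ ` CQ (i - 1) (k - s)"
      using p_diff[OF a(1) jb'] p_j[OF b'1] a(2) c(3) by simp
  qed
qed

lemma exact_quotient':
  assumes "nonzero_coh CQ dQ s i k"
  shows "nonzero_coh CA dA s i k \<or> nonzero_coh CB dB s (i + 1 - n) (k + s - 1)"
proof (rule disjCI)
  assume "\<not> nonzero_coh CB dB s (i + 1 - n) (k + s - 1)"
  then obtain z where z: "z \<in> CA i k" "dA z = 0" "p z \<notin> dQ ` CQ (i - 1) (k - s)"
    using assms exact_quotient by blast
  have "z \<notin> dA ` CA (i - 1) (k - s)"
    using z(3) p_d p_mem by fastforce
  then show "nonzero_coh CA dA s i k" using z by (auto simp: nonzero_coh_def)
qed

text \<open>Exactness at H(B): if \<open>j b = dA w\<close>, then \<open>p w\<close> is a cocycle of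
  Q that the connecting map sends to the class of \<open>b\<close>. When its class is zero,
  \<open>w\<close> can be moved into the image of \<open>j\<close>, and injectivity of
  \<open>j\<close> makes \<open>b\<close> a coboundary.\<close>

lemma exact_sub:
  assumes "nonzero_coh CB dB s i k" "\<not> nonzero_coh CQ dQ s (i + n - 1) (k + 1 - s)"
  obtains b where "b \<in> CB i k" "dB b = 0" "j b \<notin> dA ` CA (i + n - 1) (k + 1 - s)"
proof -
  obtain b where b: "b \<in> CB i k" "dB b = 0" "b \<notin> dB ` CB (i - 1) (k - s)"
    using assms by (auto simp: nonzero_coh_def)
  have "j b \<notin> dA ` CA (i + n - 1) (k + 1 - s)"
  proof
    assume "j b \<in> dA ` CA (i + n - 1) (k + 1 - s)"
    then obtain w where w: "w \<in> CA (i + n - 1) (k + 1 - s)" "j b = dA w" by auto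
    have "dQ (p w) = 0" using p_d[OF w(1)] w(2) p_j[OF b(1)] by simp
    then obtain c where c: "c \<in> CQ (i + n - 1 - 1) (k + 1 - s - s)" "p w = dQ c"
      using assms(2) p_mem[OF w(1)] by (auto simp: nonzero_coh_def)
    obtain a where a: "a \<in> CA (i + n - 1 - 1) (k + 1 - s - s)" "p a = c"
      using p_surj[OF c(1)] by auto
    have da: "dA a \<in> CA (i + n - 1) (k + 1 - s)" by (rule A.d_mem'[OF a(1)])
    have "p (w - dA a) = 0" using p_diff[OF w(1) da] p_d[OF a(1)] a c by simp
    then obtain u where u: "u \<in> CB (i + n - 1 - n) (k + 1 - s - 1)" "w - dA a = j u"
      using p_ker[OF A.diff_mem[OF w(1) da]] by auto
    have u1: "u \<in> CB (i - 1) (k - s)" using u(1) by (simp add: algebra_simps)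
    have "j (dB u) = j b"
      using j_d[OF u(1)] u(2) A.d_diff[OF w(1) da] A.d_d[OF a(1)] w(2) by simp
    then have "dB u = b" using j_cancel[OF B.d_mem'[OF u1] b(1)] by simp
    then show False using b(3) u1 by auto
  qed
  then show ?thesis using that b by blast
qed

lemma exact_sub':
  assumes "nonzero_coh CB dB s i k"
  shows "nonzero_coh CQ dQ s (i + n - 1) (k + 1 - s) \<or> nonzero_coh CA dA s (i + n) (k + 1)"
proof (rule disjCI)
  assume *: "\<not> nonzero_coh CA dA s (i + n) (k + 1)"
  show "nonzero_coh CQ dQ s (i + n - 1) (k + 1 - s)"
  proof (rule ccontr)
    assume "\<not> nonzero_coh CQ dQ s (i + n - 1) (k + 1 - s)"
    then obtain b where b: "b \<in> CB i k" "dB b = 0" "j b \<notin> dA ` CA (i + n - 1) (k + 1 - s)"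
      using assms exact_sub by blast
    then show False using * j_mem[OF b(1)] j_d[OF b(1)] j_zero
      by (auto simp: nonzero_coh_def)
  qed
qed

end

section \<open>Degree bounds carried through the exact sequence\<close>

text \<open>
  The invariant of the induction on the number of generators, for \<open>h i k\<close> standing for
  \<open>H\<^sup>i\<^sub>k \<noteq> 0\<close>: the last two clauses say that the least and the greatest degree occurring in
  \<open>H\<^sub>k\<close> are nondecreasing in \<open>k\<close>, and in particular that there are no gaps.
\<close>

definition gapless :: "(int \<Rightarrow> int \<Rightarrow> bool) \<Rightarrow> int \<Rightarrow> bool" where
  "gapless h e \<longleftrightarrow>
     (\<forall>i k. h i k \<longrightarrow> 0 \<le> i \<and> 0 \<le> k \<and> k \<le> e) \<and>
     (\<exists>N. h N e \<and> (\<forall>i k. h i k \<longrightarrow> i \<le> N)) \<and>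
     (\<forall>i k. h i (k + 1) \<longrightarrow> 0 \<le> k \<longrightarrow> (\<exists>j\<le>i. h j k)) \<and>
     (\<forall>i k. h i k \<longrightarrow> k < e \<longrightarrow> (\<exists>j\<ge>i. h j (k + 1)))"

lemma
  assumes "gapless h e"
  shows gapless_range: "h i k \<Longrightarrow> 0 \<le> i \<and> 0 \<le> k \<and> k \<le> e"
    and gapless_max: "\<exists>N. h N e \<and> (\<forall>i k. h i k \<longrightarrow> i \<le> N)"
    and gapless_down: "h i (k + 1) \<Longrightarrow> 0 \<le> k \<Longrightarrow> \<exists>j\<le>i. h j k"
    and gapless_up: "h i k \<Longrightarrow> k < e \<Longrightarrow> \<exists>j\<ge>i. h j (k + 1)"
  using assms unfolding gapless_def by blast+

lemma gapless_descend:
  assumes "gapless h e" "h i k'" "0 \<le> k" "k \<le> k'"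
  shows "\<exists>j\<le>i. h j k"
  using assms(4,2,3)
proof (induction k' arbitrary: i rule: int_ge_induct)
  case base then show ?case by auto
next
  case (step k')
  then obtain j where "j \<le> i" "h j k'"
    using gapless_down[OF assms(1), of i k'] by auto
  then show ?case using step.IH[of j] step.prems by (meson order.trans)
qed

lemma gapless_ascend:
  assumes "gapless h e" "h i k" "k \<le> k'" "k' \<le> e"
  shows "\<exists>j\<ge>i. h j k'"
  using assms(3,4)
proof (induction k' rule: int_ge_induct)
  case base then show ?case using assms by auto
next
  case (step k')
  then obtain j where j: "j \<ge> i" "h j k'" by auto
  then obtain j' where "j' \<ge> j" "h j' (k' + 1)"
    using gapless_up[OF assms(1) j(2)] step.prems by auto
  then show ?case using j by (meson order.trans)
qed

lemma gapless_nonempty: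
  assumes "gapless h e" "0 \<le> k" "k \<le> e"
  shows "\<exists>i. h i k"
  using gapless_max[OF assms(1)] gapless_descend[OF assms(1) _ assms(2,3)] by blast

text \<open>If the target of the connecting map is nonzero, descending from word-length
  \<open>k + s - 1\<close> to \<open>k\<close> gives a class of degree at most
  \<open>i + 1 - n\<close>, hence below \<open>i\<close>. As degrees are nonnegative, the process
  stops.\<close>

lemma gapless_bottom:
  assumes g: "gapless h e" and "h i k" and "1 \<le> s" "2 \<le> n"
  obtains j where "j \<le> i" "h j k" "\<not> h (j + 1 - n) (k + s - 1)"
proof -
  have "\<exists>j\<le>i. h j k \<and> \<not> h (j + 1 - n) (k + s - 1)" using assms(2)
  proof (induction "nat i" arbitrary: i rule: less_induct)
    case less
    show ?case
    proof (cases "h (i + 1 - n) (k + s - 1)")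
      case True
      obtain j where j: "j \<le> i + 1 - n" "h j k"
        using gapless_descend[OF g True, of k] less.prems assms(3) g
        unfolding gapless_def by auto
      have "0 \<le> j" using g j(2) unfolding gapless_def by auto
      then have "nat j < nat i" using j(1) assms(4) by linarith
      from less.hyps[OF this j(2)] obtain j' where "j' \<le> j" "h j' k" "\<not> h (j' + 1 - n) (k + s - 1)"
        by blast
      then show ?thesis using j(1) assms(4) by (intro exI[of _ j']) auto
    qed (use less.prems in auto)
  qed
  then show ?thesis using that by auto
qed

text \<open>Dual to \<open>gapless_bottom\<close>: the source of the connecting map has word-length
  at most \<open>k\<close>, and ascending from it gives a class of larger degree, while degrees are
  bounded above.\<close>

lemma gapless_top:
  assumes g: "gapless h e" and "h i k" and "1 \<le> s" "2 \<le> n"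
  obtains j where "i \<le> j" "h j k" "\<not> h (j + n - 1) (k + 1 - s)"
proof -
  obtain N where N: "\<And>i k. h i k \<Longrightarrow> i \<le> N" using g unfolding gapless_def by blast
  have "\<exists>j\<ge>i. h j k \<and> \<not> h (j + n - 1) (k + 1 - s)" using assms(2)
  proof (induction "nat (N - i)" arbitrary: i rule: less_induct)
    case less
    show ?case
    proof (cases "h (i + n - 1) (k + 1 - s)")
      case True
      obtain j where j: "j \<ge> i + n - 1" "h j k"
        using gapless_ascend[OF g True, of k] less.prems assms(3) g
        unfolding gapless_def by auto
      then have "nat (N - j) < nat (N - i)" using N[OF j(2)] assms(4) by linarith
      from less.hyps[OF this j(2)] obtain j' where "j' \<ge> j" "h j' k" "\<not> h (j' + n - 1) (k + 1 - s)"
        by blast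
      then show ?thesis using j(1) assms(4) by (intro exI[of _ j']) auto
    qed (use less.prems in auto)
  qed
  then show ?thesis using that by auto
qed

text \<open>Here \<open>h\<close> stands for A and \<open>h'\<close> for both Q and B;
  \<open>s1\<close>, \<open>s2\<close>, \<open>s3\<close> are exactness at A, Q and B.\<close>

lemma gapless_odd_step:
  assumes s1: "\<And>i k. h i k \<Longrightarrow> h' (i - n) (k - 1) \<or> h' i k"
    and s2: "\<And>i k. h' i k \<Longrightarrow> h i k \<or> h' (i + 1 - n) (k + s - 1)"
    and s3: "\<And>i k. h' i k \<Longrightarrow> h' (i + n - 1) (k + 1 - s) \<or> h (i + n) (k + 1)"
    and g: "gapless h' e" and "1 \<le> s" "2 \<le> n"
  shows "gapless h (e + 1)"
proof -
  \<comment> \<open>\<open>bot\<close> lifts a class along the projection and \<open>top\<close>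
    multiplies one by the generator, after choosing a class for which the connecting map is no
    obstruction.\<close>
  have bot: "\<exists>j\<le>i. h j k" if "h' i k" for i k
    using gapless_bottom[OF g that assms(5,6)] s2 by metis
  have top: "\<exists>j\<ge>i. h (j + n) (k + 1)" if "h' i k" for i k
    using gapless_top[OF g that assms(5,6)] s3 by metis
  have rng: "0 \<le> i \<and> 0 \<le> k \<and> k \<le> e" if "h' i k" for i k
    using g that unfolding gapless_def by blast
  obtain N where N: "h' N e" "\<And>i k. h' i k \<Longrightarrow> i \<le> N" using g unfolding gapless_def by blast
  have "0 \<le> i \<and> 0 \<le> k \<and> k \<le> e + 1" if "h i k" for i k
    using s1[OF that] rng[of "i - n" "k - 1"] rng[of i k] assms(6) by auto
  \<comment> \<open>The other alternative in \<open>s3\<close> would have degree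
    \<open>N + n - 1\<close>, above the maximum \<open>N\<close>.\<close>
  moreover have "h (N + n) (e + 1)"
    using s3[OF N(1)] N(2)[of "N + n - 1"] assms(6) by auto
  moreover have "i \<le> N + n" if "h i k" for i k
    using s1[OF that] N(2)[of "i - n" "k - 1"] N(2)[of i k] assms(6) by auto
  moreover have "\<exists>j\<le>i. h j k" if "h i (k + 1)" and k: "0 \<le> k" for i k
    using s1[OF that(1)]
  proof
    assume "h' (i - n) (k + 1 - 1)"
    then obtain j where "j \<le> i - n" "h j k" using bot[of "i - n" k] by auto
    then show ?thesis using assms(6) by (intro exI[of _ j]) auto
  next
    assume *: "h' i (k + 1)"
    then obtain j where "j \<le> i" "h' j k"
      using gapless_descend[OF g * k] by auto
    then show ?thesis using bot[of j k] by (meson order.trans)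
  qed
  moreover have "\<exists>j\<ge>i. h j (k + 1)" if "h i k" and k: "k < e + 1" for i k
    using s1[OF that(1)]
  proof
    assume *: "h' (i - n) (k - 1)"
    then obtain j where "i - n \<le> j" "h' j k"
      using gapless_ascend[OF g *, of k] k by auto
    then obtain j' where "j \<le> j'" "h (j' + n) (k + 1)" using top[of j k] by auto
    then show ?thesis using \<open>i - n \<le> j\<close> by (intro exI[of _ "j' + n"]) auto
  next
    assume "h' i k"
    then obtain j where "i \<le> j" "h (j + n) (k + 1)" using top[of i k] by auto
    then show ?thesis using assms(6) by (intro exI[of _ "j + n"]) auto
  qed
  ultimately show ?thesis unfolding gapless_def by blast
qed

text \<open>Now B is A itself, so the alternatives relate \<open>h\<close> to itself and each
  property of \<open>h\<close> needs its own induction. The bound \<open>M\<close> makes the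
  inductions on decreasing word-length well-founded.\<close>

lemma gapless_even_step:
  assumes s1: "\<And>i k. h i k \<Longrightarrow> h (i - n) (k - 1) \<or> h' i k"
    and s2: "\<And>i k. h' i k \<Longrightarrow> h i k \<or> h (i + 1 - n) (k + s - 1)"
    and s3: "\<And>i k. h i k \<Longrightarrow> h' (i + n - 1) (k + 1 - s) \<or> h (i + n) (k + 1)"
    and g: "gapless h' e" and s: "1 \<le> s" and n: "2 \<le> n"
    and bnd: "\<And>i k. h i k \<Longrightarrow> 0 \<le> i \<and> 0 \<le> k \<and> k \<le> M"
  shows "gapless h (e + s - 1)"
proof -
  have rng: "0 \<le> i \<and> 0 \<le> k \<and> k \<le> e" if "h' i k" for i k
    using g that unfolding gapless_def by blast
  obtain N where N: "h' N e" "\<And>i k. h' i k \<Longrightarrow> i \<le> N" using g unfolding gapless_def by blast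
  \<comment> \<open>Repeated multiplication by the generator must reach zero, since word-length is
    bounded. At that point \<open>s3\<close> yields a class of Q, whose bidegree bounds the original
    one.\<close>
  have le: "k \<le> e + s - 1 \<and> i \<le> N + 1 - n" if "h i k" for i k
    using that
  proof (induction "nat (M - k)" arbitrary: i k rule: less_induct)
    case less
    consider "h' (i + n - 1) (k + 1 - s)" | "h (i + n) (k + 1)" using s3[OF less.prems] by blast
    then show ?case
    proof cases
      case 1 then show ?thesis using rng[OF 1] N(2)[OF 1] by linarith
    next
      case 2
      then have "nat (M - (k + 1)) < nat (M - k)" using bnd[OF 2] by linarith
      from less.hyps[OF this 2] n show ?thesis by linarith
    qed
  qed
  \<comment> \<open>\<open>le\<close> excludes the alternative \<open>h N e\<close>, since
    \<open>N + 1 - n < N\<close>; so the top class of A comes from the connecting map.\<close>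
  have "h (N + 1 - n) (e + s - 1)"
    using s2[OF N(1)] le[of N e] n by auto
  \<comment> \<open>The outer induction supplies descent at all larger word-lengths, which
    \<open>dsc\<close> iterates down to \<open>k + 1\<close>; the inner induction is on the
    degree.\<close>
  have desc: "\<exists>j\<le>i. h j k" if "h i (k + 1)" "0 \<le> k" for i k
    using that
  proof (induction "nat (M - k)" arbitrary: i k rule: less_induct)
    case outer: less
    note IH = outer.hyps
    have dsc: "\<exists>j\<le>i. h j (k + 1)" if "h i k'" "k + 1 \<le> k'" for i k'
      using that(2,1)
    proof (induction k' arbitrary: i rule: int_ge_induct)
      case base then show ?case by auto
    next
      case (step k')
      have "nat (M - k') < nat (M - k)" using bnd[OF step.prems] step.hyps by linarith
      from IH[OF this step.prems] obtain j where "j \<le> i" "h j k'"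
        using step.hyps outer.prems(2) by auto
      then show ?case using step.IH[of j] by (meson order.trans)
    qed
    show ?case using outer.prems(1)
    proof (induction "nat i" arbitrary: i rule: less_induct)
      case less
      consider "h (i - n) k" | "h' i (k + 1)" using s1[OF less.prems] by auto
      then show ?case
      proof cases
        case 1 then show ?thesis using n by (intro exI[of _ "i - n"]) auto
      next
        case 2
        then obtain j where j: "j \<le> i" "h' j k"
          using gapless_descend[OF g 2, of k] outer.prems(2) by auto
        from s2[OF j(2)] show ?thesis
        proof
          assume "h j k" then show ?thesis using j by auto
        next
          \<comment> \<open>Unless \<open>s = 1\<close>, this class has word-length at least
            \<open>k + 1\<close>; \<open>dsc\<close> brings it to \<open>k + 1\<close> in a degree
            below \<open>i\<close>, where the inner hypothesis applies.\<close>
          assume a: "h (j + 1 - n) (k + s - 1)"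
          show ?thesis
          proof (cases "s = 1")
            case True then show ?thesis using a j n by (intro exI[of _ "j + 1 - n"]) auto
          next
            case False
            then obtain i' where i': "i' \<le> j + 1 - n" "h i' (k + 1)"
              using dsc[OF a] s by auto
            then have "nat i' < nat i" using bnd[OF i'(2)] j n by linarith
            from less.hyps[OF this i'(2)] obtain j' where "j' \<le> i'" "h j' k" by blast
            then show ?thesis using i' j n by (intro exI[of _ j']) auto
          qed
        qed
      qed
    qed
  qed
  \<comment> \<open>Mirror image of \<open>desc\<close>: the outer induction is on \<open>k\<close>,
    the inner one on the distance of the degree from \<open>N\<close>.\<close>
  have asc: "\<exists>j\<ge>i. h j (k + 1)" if "h i k" "k < e + s - 1" for i k
    using that
  proof (induction "nat k" arbitrary: i k rule: less_induct)
    case outer: less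
    note IH = outer.hyps
    have asc': "\<exists>j\<ge>i. h j k" if "h i k0" "k0 \<le> k" for i k0
    proof -
      have "\<exists>j\<ge>i. h j k'" if "k0 \<le> k'" "k' \<le> k" for k'
        using that
      proof (induction k' rule: int_ge_induct)
        case base then show ?case using \<open>h i k0\<close> by auto
      next
        case (step k')
        then obtain j where j: "j \<ge> i" "h j k'" by auto
        have "nat k' < nat k" using step.prems bnd[OF \<open>h i k0\<close>] step.hyps by linarith
        from IH[OF this j(2)] obtain j' where "j' \<ge> j" "h j' (k' + 1)"
          using step.prems outer.prems(2) by auto
        then show ?case using j by (meson order.trans)
      qed
      then show ?thesis using that by auto
    qed
    show ?case using outer.prems(1)
    proof (induction "nat (N - i)" arbitrary: i rule: less_induct)
      case less
      from s3[OF less.prems] show ?case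
      proof
        assume "h (i + n) (k + 1)"
        then show ?thesis using n by (intro exI[of _ "i + n"]) auto
      next
        assume a: "h' (i + n - 1) (k + 1 - s)"
        \<comment> \<open>Moving the class of Q up by one word-length makes the target of its
          connecting map have word-length exactly \<open>k + 1\<close>.\<close>
        then obtain j where j: "j \<ge> i + n - 1" "h' j (k + 1 - s + 1)"
          using gapless_ascend[OF g a, of "k + 1 - s + 1"] outer.prems(2) by auto
        from s2[OF j(2)] show ?thesis
        proof
          assume "h (j + 1 - n) (k + 1 - s + 1 + s - 1)"
          then show ?thesis using j by (intro exI[of _ "j + 1 - n"]) (auto simp: add.commute)
        next
          assume b: "h j (k + 1 - s + 1)"
          show ?thesis
          proof (cases "s = 1")
            case True then show ?thesis using b j n by (intro exI[of _ j]) auto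
          next
            case False
            then obtain j' where j': "j' \<ge> j" "h j' k" using asc'[OF b] s by auto
            then have "nat (N - j') < nat (N - i)" using le[OF j'(2)] j n by linarith
            from less.hyps[OF this j'(2)] obtain j'' where "j'' \<ge> j'" "h j'' (k + 1)" by blast
            then show ?thesis using j' j n by (intro exI[of _ j'']) auto
          qed
        qed
      qed
    qed
  qed
  have "0 \<le> i \<and> 0 \<le> k \<and> k \<le> e + s - 1" if "h i k" for i k
    using bnd[OF that] le[OF that] by auto
  moreover have "\<exists>N. h N (e + s - 1) \<and> (\<forall>i k. h i k \<longrightarrow> i \<le> N)"
    using \<open>h (N + 1 - n) (e + s - 1)\<close> le by blast
  ultimately show ?thesis using desc asc unfolding gapless_def by blast
qed

section \<open>Multiplication by a generator\<close>

lemma single_sum_keys: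
  assumes "finite M" "Poly_Mapping.keys a \<subseteq> M"
  shows "(\<Sum>m\<in>M. Poly_Mapping.single m (Poly_Mapping.lookup a m)) = a"
proof (rule poly_mapping_eqI)
  fix n
  have "(\<Sum>m\<in>M. Poly_Mapping.lookup a m when m = n) = (Poly_Mapping.lookup a n when n \<in> M)"
    using assms(1) by (simp add: when_def)
  also have "\<dots> = Poly_Mapping.lookup a n"
    using assms(2) by (auto simp: when_def in_keys_iff)
  finally show "Poly_Mapping.lookup (\<Sum>m\<in>M. Poly_Mapping.single m (Poly_Mapping.lookup a m)) n
    = Poly_Mapping.lookup a n"
    by (simp add: lookup_sum lookup_single)
qed

text \<open>Common finite index sets let products of elements with different supports be compared
  termwise.\<close>

lemma gmult_superset:
  assumes "finite M" "finite N" "Poly_Mapping.keys p \<subseteq> M" "Poly_Mapping.keys q \<subseteq> N"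
  shows "gmult deg p q = (\<Sum>m\<in>M. \<Sum>n\<in>N. Poly_Mapping.single (m + n)
           (koszul_sign deg m n * Poly_Mapping.lookup p m * Poly_Mapping.lookup q n))"
proof -
  have "gmult deg p q = (\<Sum>m\<in>Poly_Mapping.keys p. \<Sum>n\<in>N. Poly_Mapping.single (m + n)
           (koszul_sign deg m n * Poly_Mapping.lookup p m * Poly_Mapping.lookup q n))"
    unfolding gmult_def
    by (intro sum.cong sum.mono_neutral_left) (use assms in \<open>auto simp: in_keys_iff\<close>)
  also have "\<dots> = (\<Sum>m\<in>M. \<Sum>n\<in>N. Poly_Mapping.single (m + n)
           (koszul_sign deg m n * Poly_Mapping.lookup p m * Poly_Mapping.lookup q n))"
    by (intro sum.mono_neutral_left) (use assms in \<open>auto simp: in_keys_iff\<close>)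
  finally show ?thesis .
qed

lemma gmult_add_left: "gmult deg (p + p') q = gmult deg p q + gmult deg p' q"
proof -
  let ?M = "Poly_Mapping.keys p \<union> Poly_Mapping.keys p' \<union> Poly_Mapping.keys (p + p')"
  show ?thesis
    by (subst (1 2 3) gmult_superset[of ?M "Poly_Mapping.keys q"])
      (auto simp: lookup_add algebra_simps single_add sum.distrib)
qed

lemma gmult_add_right: "gmult deg p (q + q') = gmult deg p q + gmult deg p q'"
proof -
  let ?M = "Poly_Mapping.keys q \<union> Poly_Mapping.keys q' \<union> Poly_Mapping.keys (q + q')"
  show ?thesis
    by (subst (1 2 3) gmult_superset[of "Poly_Mapping.keys p" ?M])
      (auto simp: lookup_add algebra_simps single_add sum.distrib)
qed

lemma gmult_zero_left [simp]: "gmult deg 0 q = 0"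
  and gmult_zero_right [simp]: "gmult deg p 0 = 0"
  by (simp_all add: gmult_def)

lemma qscale_single [simp]: "qscale c (Poly_Mapping.single m b) = Poly_Mapping.single m (c * b)"
  by (intro poly_mapping_eqI) (simp add: lookup_qscale lookup_single when_def)

lemma keys_qscale_subset: "Poly_Mapping.keys (qscale c a) \<subseteq> Poly_Mapping.keys a"
  by (auto simp: in_keys_iff lookup_qscale)

lemma gmult_scale_left: "gmult deg (qscale c p) q = qscale c (gmult deg p q)"
  by (subst (1 2) gmult_superset[of "Poly_Mapping.keys p" "Poly_Mapping.keys q"])
    (use keys_qscale_subset in \<open>auto simp: lookup_qscale elt.scale_sum_right algebra_simps\<close>)

lemma gmult_scale_right: "gmult deg p (qscale c q) = qscale c (gmult deg p q)"
  by (subst (1 2) gmult_superset[of "Poly_Mapping.keys p" "Poly_Mapping.keys q"])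
    (use keys_qscale_subset in \<open>auto simp: lookup_qscale elt.scale_sum_right algebra_simps\<close>)

lemma qscale_minus_one [simp]: "qscale (- 1) a = - a"
  by simp

lemma gmult_minus_right: "gmult deg p (- q) = - gmult deg p q"
  using gmult_scale_right[of deg p "-1" q] by simp

lemma gmult_diff_right: "gmult deg p (q - q') = gmult deg p q - gmult deg p q'"
  using gmult_add_right[of deg p q "- q'"] by (simp add: gmult_minus_right)

lemma gmult_single:
  "gmult deg (Poly_Mapping.single m a) (Poly_Mapping.single n b) =
     Poly_Mapping.single (m + n) (koszul_sign deg m n * a * b)"
  by (subst gmult_superset[of "{m}" "{n}"]) auto

text \<open>\<open>Lam\<close> and all its graded pieces have this form, so closure and induction
  are proved once.\<close>

definition supp_on :: "mono set \<Rightarrow> elt set" where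
  "supp_on P = {a. Poly_Mapping.keys a \<subseteq> P}"

lemma supp_on_zero [simp, intro]: "0 \<in> supp_on P"
  by (simp add: supp_on_def)

lemma supp_on_add: "a \<in> supp_on P \<Longrightarrow> b \<in> supp_on P \<Longrightarrow> a + b \<in> supp_on P"
  using Poly_Mapping.keys_add[of a b] by (auto simp: supp_on_def)

lemma supp_on_scale: "a \<in> supp_on P \<Longrightarrow> qscale c a \<in> supp_on P"
  using keys_qscale_subset[of c a] by (auto simp: supp_on_def)

lemma supp_on_uminus: "a \<in> supp_on P \<Longrightarrow> - a \<in> supp_on P"
  using supp_on_scale[of a P "-1"] by simp

lemma supp_on_diff: "a \<in> supp_on P \<Longrightarrow> b \<in> supp_on P \<Longrightarrow> a - b \<in> supp_on P"
  using supp_on_add[of a P "- b"] supp_on_uminus[of b P] by simp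

lemma supp_on_sum: "(\<And>x. x \<in> S \<Longrightarrow> f x \<in> supp_on P) \<Longrightarrow> (\<Sum>x\<in>S. f x) \<in> supp_on P"
  by (induction S rule: infinite_finite_induct) (auto intro: supp_on_add)

lemma supp_on_single: "m \<in> P \<or> c = 0 \<Longrightarrow> Poly_Mapping.single m c \<in> supp_on P"
  by (auto simp: supp_on_def)

lemma supp_on_mono: "a \<in> supp_on P \<Longrightarrow> P \<subseteq> Q \<Longrightarrow> a \<in> supp_on Q"
  by (auto simp: supp_on_def)

lemma supp_on_lookup: "a \<in> supp_on P \<longleftrightarrow> (\<forall>m. m \<notin> P \<longrightarrow> Poly_Mapping.lookup a m = 0)"
  by (auto simp: supp_on_def in_keys_iff)

lemma supp_on_disjoint: "a \<in> supp_on P \<Longrightarrow> a \<in> supp_on Q \<Longrightarrow> P \<inter> Q = {} \<Longrightarrow> a = 0"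
  using keys_eq_empty[of a] by (auto simp: supp_on_def simp del: keys_eq_empty)

text \<open>The summands stay in \<open>supp_on P\<close> because the differential is assumed
  additive only on \<open>Lam X deg\<close>.\<close>

lemma supp_on_induct [consumes 1, case_names zero single add]:
  assumes "a \<in> supp_on P"
    and "Q 0"
    and single: "\<And>m c. m \<in> P \<Longrightarrow> Q (Poly_Mapping.single m c)"
    and add: "\<And>a b. a \<in> supp_on P \<Longrightarrow> b \<in> supp_on P \<Longrightarrow> Q a \<Longrightarrow> Q b \<Longrightarrow> Q (a + b)"
  shows "Q a"
proof -
  have "Q (\<Sum>m\<in>M. Poly_Mapping.single m (Poly_Mapping.lookup a m))"
    if "finite M" "M \<subseteq> P" for M
    using that
  proof (induction M rule: finite_induct)
    case (insert m M)
    show ?case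
      unfolding sum.insert[OF insert.hyps]
      by (rule add) (use insert in \<open>auto intro!: supp_on_sum supp_on_single single\<close>)
  qed (use \<open>Q 0\<close> in auto)
  from this[of "Poly_Mapping.keys a"] show ?thesis
    using assms(1) single_sum_keys[of "Poly_Mapping.keys a" a] by (simp add: supp_on_def)
qed

lemma elt_induct [case_names zero single add]:
  assumes "Q 0" and "\<And>m c. Q (Poly_Mapping.single m c)"
    and "\<And>a b. Q a \<Longrightarrow> Q b \<Longrightarrow> Q (a + b)"
  shows "Q (a :: elt)"
  by (rule supp_on_induct[of a UNIV]) (use assms in \<open>auto simp: supp_on_def\<close>)

text \<open>Pairs with zero Koszul sign contribute nothing, while their sum may contain an odd
  generator twice and leave the basis; hence the restriction to nonzero signs.\<close>

lemma supp_on_gmult: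
  assumes "a \<in> supp_on P" "b \<in> supp_on Q"
    and "\<And>m n. m \<in> P \<Longrightarrow> n \<in> Q \<Longrightarrow> koszul_sign deg m n \<noteq> 0 \<Longrightarrow> m + n \<in> R"
  shows "gmult deg a b \<in> supp_on R"
  unfolding gmult_def using assms
  by (intro supp_on_sum supp_on_single) (auto simp: supp_on_def)

lemma keys_add_nat: "Poly_Mapping.keys (m + n :: mono) = Poly_Mapping.keys m \<union> Poly_Mapping.keys n"
  by (auto simp: in_keys_iff lookup_add)

lemma word_length_superset:
  "finite S \<Longrightarrow> Poly_Mapping.keys m \<subseteq> S \<Longrightarrow> word_length m = (\<Sum>x\<in>S. Poly_Mapping.lookup m x)"
  unfolding word_length_def by (intro sum.mono_neutral_left) (auto simp: in_keys_iff)

lemma mono_degree_superset: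
  "finite S \<Longrightarrow> Poly_Mapping.keys m \<subseteq> S \<Longrightarrow>
     mono_degree deg m = (\<Sum>x\<in>S. Poly_Mapping.lookup m x * deg x)"
  unfolding mono_degree_def by (intro sum.mono_neutral_left) (auto simp: in_keys_iff)

lemma word_length_add [simp]: "word_length (m + n) = word_length m + word_length n"
  by (subst (1 2 3) word_length_superset[of "Poly_Mapping.keys m \<union> Poly_Mapping.keys n"])
    (auto simp: keys_add_nat lookup_add sum.distrib)

lemma mono_degree_add [simp]: "mono_degree deg (m + n) = mono_degree deg m + mono_degree deg n"
  by (subst (1 2 3) mono_degree_superset[of "Poly_Mapping.keys m \<union> Poly_Mapping.keys n"])
    (auto simp: keys_add_nat lookup_add sum.distrib algebra_simps)

section \<open>Koszul signs and graded commutativity\<close>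

definition mvar :: "nat \<Rightarrow> mono" where "mvar x = Poly_Mapping.single x 1"

lemma keys_mvar [simp]: "Poly_Mapping.keys (mvar x) = {x}"
  by (simp add: mvar_def)

lemma lookup_mvar: "Poly_Mapping.lookup (mvar x) y = (if y = x then 1 else 0)"
  by (simp add: mvar_def lookup_single when_def)

lemma word_length_mvar [simp]: "word_length (mvar x) = 1"
  by (simp add: word_length_def lookup_mvar)

lemma mono_degree_mvar [simp]: "mono_degree deg (mvar x) = deg x"
  by (simp add: mono_degree_def lookup_mvar)

lemma mvar_split:
  assumes "x \<in> Poly_Mapping.keys m"
  obtains n where "m = mvar x + n"
proof
  show "m = mvar x + (m - mvar x)"
    using assms by (intro poly_mapping_eqI)
      (auto simp: lookup_add lookup_minus lookup_mvar in_keys_iff)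
qed

lemma word_length_0 [simp]: "word_length 0 = 0" and mono_degree_0 [simp]: "mono_degree deg 0 = 0"
  by (simp_all add: word_length_def mono_degree_def)

lemma word_length_eq_0: "word_length m = 0 \<longleftrightarrow> m = 0"
proof
  assume "word_length m = 0"
  then have "Poly_Mapping.keys m = {}"
    unfolding word_length_def by (metis all_not_in_conv finite_keys in_keys_iff sum_eq_0_iff)
  then show "m = 0" by simp
qed simp

lemma word_length_eq_1:
  assumes "word_length m = 1"
  obtains x where "m = mvar x"
proof -
  obtain x where "x \<in> Poly_Mapping.keys m"
    using assms by (metis all_not_in_conv keys_eq_empty word_length_0 zero_neq_one)
  then obtain n where n: "m = mvar x + n" by (rule mvar_split)
  then have "n = 0" using assms by (simp add: word_length_eq_0)
  then show ?thesis using n that by simp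
qed

lemma mvar_inj [simp]: "mvar x = mvar y \<longleftrightarrow> x = y"
  by (metis keys_mvar singleton_inject)

lemma koszul_sign_mvar:
  "koszul_sign deg (mvar x) n =
     (if even (deg x) then 1 else if x \<in> Poly_Mapping.keys n then 0
      else (- 1) ^ card {y \<in> Poly_Mapping.keys n. odd (deg y) \<and> y < x})"
proof -
  have "{(x', y). x' \<in> Poly_Mapping.keys (mvar x) \<and> y \<in> Poly_Mapping.keys n \<and>
           odd (deg x') \<and> odd (deg y) \<and> y < x'} =
        (if even (deg x) then {} else Pair x ` {y \<in> Poly_Mapping.keys n. odd (deg y) \<and> y < x})"
    by auto
  then show ?thesis
    by (auto simp: koszul_sign_def card_image inj_on_def)
qed

text \<open>A nonzero sign is its own inverse, so division by a generator can use the same sign as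
  multiplication.\<close>

lemma koszul_sign_mvar_sq:
  "koszul_sign deg (mvar x) n \<noteq> 0 \<Longrightarrow> koszul_sign deg (mvar x) n * koszul_sign deg (mvar x) n = 1"
  by (auto simp: koszul_sign_mvar simp flip: power_add split: if_splits)

text \<open>An even generator affects no sign, and a repeated odd generator makes both sides zero.
  For distinct odd \<open>x\<close> and \<open>y\<close> outside \<open>m\<close>, exactly one of
  the two orders has an extra inversion.\<close>

lemma koszul_sign_commute:
  "koszul_sign deg (mvar x) (mvar y + m) * koszul_sign deg (mvar y) m =
     (- 1) ^ (deg x * deg y) * (koszul_sign deg (mvar y) (mvar x + m) * koszul_sign deg (mvar x) m)"
proof (cases "even (deg x) \<or> even (deg y) \<or> x = y \<or> x \<in> Poly_Mapping.keys m \<or> y \<in> Poly_Mapping.keys m")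
  case True
  then show ?thesis
  proof (elim disjE)
    assume e: "even (deg x)"
    show ?thesis
    proof (cases "even (deg y)")
      case False
      then have "{z \<in> Poly_Mapping.keys (mvar x + m). odd (deg z) \<and> z < y} =
          {z \<in> Poly_Mapping.keys m. odd (deg z) \<and> z < y}"
        using e by (auto simp: keys_add_nat)
      then show ?thesis using e False by (auto simp: koszul_sign_mvar keys_add_nat)
    qed (use e in \<open>simp add: koszul_sign_mvar\<close>)
  next
    assume e: "even (deg y)"
    show ?thesis
    proof (cases "even (deg x)")
      case False
      then have "{z \<in> Poly_Mapping.keys (mvar y + m). odd (deg z) \<and> z < x} =
          {z \<in> Poly_Mapping.keys m. odd (deg z) \<and> z < x}"
        using e by (auto simp: keys_add_nat)
      then show ?thesis using e False by (auto simp: koszul_sign_mvar keys_add_nat)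
    qed (use e in \<open>simp add: koszul_sign_mvar\<close>)
  next
    assume "x = y" then show ?thesis by (auto simp: koszul_sign_mvar keys_add_nat)
  next
    assume "x \<in> Poly_Mapping.keys m"
    then show ?thesis
      by (cases "even (deg y)"; cases "even (deg x)")
        (auto simp: koszul_sign_mvar keys_add_nat insert_absorb)
  next
    assume "y \<in> Poly_Mapping.keys m"
    then show ?thesis
      by (cases "even (deg y)"; cases "even (deg x)")
        (auto simp: koszul_sign_mvar keys_add_nat insert_absorb)
  qed
next
  case False
  have c: "card {z \<in> Poly_Mapping.keys (mvar y + m). odd (deg z) \<and> z < x} =
      card {z \<in> Poly_Mapping.keys m. odd (deg z) \<and> z < x} + (if y < x then 1 else 0)"
    if "odd (deg y)" "y \<notin> Poly_Mapping.keys m" for x y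
  proof -
    have "{z \<in> Poly_Mapping.keys (mvar y + m). odd (deg z) \<and> z < x} =
      (if y < x then insert y {z \<in> Poly_Mapping.keys m. odd (deg z) \<and> z < x}
       else {z \<in> Poly_Mapping.keys m. odd (deg z) \<and> z < x})"
      using that by (auto simp: keys_add_nat)
    then show ?thesis using that by simp
  qed
  consider "x < y" | "y < x" using False by linarith
  then show ?thesis
    using False c[of y x] c[of x y]
    by cases (auto simp: koszul_sign_mvar keys_add_nat)
qed

abbreviation gen :: "nat \<Rightarrow> elt" where "gen x \<equiv> Poly_Mapping.single (mvar x) 1"

text \<open>Stated for linear forms because the odd cocycle may be a combination of generators.
  Comparing left multiplications on monomials avoids associativity of \<open>gmult\<close>.\<close>

lemma gmult_linear_commute:
  assumes "v \<in> supp_on {m. word_length m = 1 \<and> mono_degree deg m = n}"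
  shows "gmult deg (gen x) (gmult deg v a) =
           qscale ((- 1) ^ (deg x * n)) (gmult deg v (gmult deg (gen x) a))"
  using assms
proof (induction v rule: supp_on_induct)
  case (single m c)
  then obtain y where y: "m = mvar y" "deg y = n"
    using word_length_eq_1 by (metis (mono_tags, lifting) mem_Collect_eq mono_degree_mvar)
  show ?case
  proof (induction a rule: elt_induct)
    case (single k b)
    have "koszul_sign deg (mvar x) (mvar y + k) * (koszul_sign deg (mvar y) k * c * b) =
        (- 1) ^ (deg x * n) * (koszul_sign deg (mvar y) (mvar x + k) * c * (koszul_sign deg (mvar x) k * b))"
      using koszul_sign_commute[of deg x y k] y(2) by (simp add: algebra_simps)
    moreover have "mvar x + (mvar y + k) = mvar y + (mvar x + k)" by (simp add: add.left_commute)
    ultimately show ?case unfolding y(1) gmult_single qscale_single by (simp only: mult_1_right)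
  qed (simp_all add: gmult_add_right elt.scale_right_distrib)
qed (simp_all add: gmult_add_right gmult_add_left elt.scale_right_distrib)

lemma gmult_linear_linear:
  assumes "v \<in> supp_on {m. word_length m = 1 \<and> mono_degree deg m = n}"
    and "w \<in> supp_on {m. word_length m = 1 \<and> mono_degree deg m = k}"
  shows "gmult deg w (gmult deg v a) = qscale ((- 1) ^ (k * n)) (gmult deg v (gmult deg w a))"
  using assms(2)
proof (induction w rule: supp_on_induct)
  case (single m c)
  then obtain y where y: "m = mvar y" "deg y = k"
    using word_length_eq_1 by (metis (mono_tags, lifting) mem_Collect_eq mono_degree_mvar)
  have "Poly_Mapping.single m c = qscale c (gen y)" using y by simp
  then show ?case
    using gmult_linear_commute[OF assms(1), of y a] y
    by (simp only: gmult_scale_left gmult_scale_right elt.scale_scale mult.commute)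
qed (simp_all add: gmult_add_right gmult_add_left elt.scale_right_distrib)

text \<open>For odd \<open>n\<close> the commutation sign is -1, so the product equals its own
  negative.\<close>

lemma gmult_odd_linear_square:
  assumes "v \<in> supp_on {m. word_length m = 1 \<and> mono_degree deg m = n}" "odd n"
  shows "gmult deg v (gmult deg v a) = 0"
proof -
  have "gmult deg v (gmult deg v a) = - gmult deg v (gmult deg v a)"
    using gmult_linear_linear[OF assms(1) assms(1), of a] assms(2) by simp
  then show ?thesis
    by (metis (no_types, opaque_lifting) elt.scale_cancel_right elt.scale_minus_left elt.scale_one
        one_neq_neg_one)
qed

section \<open>Division by a cocycle generator\<close>

definition keep :: "mono set \<Rightarrow> elt \<Rightarrow> elt" where
  "keep P a = Poly_Mapping.mapp (\<lambda>m c. c when m \<in> P) a"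

lemma lookup_keep: "Poly_Mapping.lookup (keep P a) m = (Poly_Mapping.lookup a m when m \<in> P)"
  by (auto simp: keep_def lookup_mapp when_def in_keys_iff)

lemma keep_zero [simp]: "keep P 0 = 0"
  by (intro poly_mapping_eqI) (simp add: lookup_keep when_def)

lemma keep_add: "keep P (a + b) = keep P a + keep P b"
  by (intro poly_mapping_eqI) (simp add: lookup_keep lookup_add when_def)

lemma keep_diff: "keep P (a - b) = keep P a - keep P b"
  by (intro poly_mapping_eqI) (simp add: lookup_keep lookup_minus when_def)

lemma keep_scale: "keep P (qscale c a) = qscale c (keep P a)"
  by (intro poly_mapping_eqI) (simp add: lookup_keep lookup_qscale when_def)

lemma keep_id: "a \<in> supp_on P \<Longrightarrow> keep P a = a"
  by (intro poly_mapping_eqI) (auto simp: lookup_keep supp_on_lookup when_def)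

lemma keep_eq_0: "a \<in> supp_on Q \<Longrightarrow> P \<inter> Q = {} \<Longrightarrow> keep P a = 0"
  by (intro poly_mapping_eqI) (auto simp: lookup_keep supp_on_lookup when_def)

lemma keep_mem: "a \<in> supp_on Q \<Longrightarrow> P \<inter> Q \<subseteq> R \<Longrightarrow> keep P a \<in> supp_on R"
  by (auto simp: lookup_keep supp_on_lookup when_def)

text \<open>Left division by \<open>gen x\<close>: for \<open>a\<close> in \<open>Lam X deg\<close>,
  the part of \<open>a\<close> involving \<open>x\<close> is \<open>gen x\<close> times this
  element. Unlike a partial derivative it carries no multiplicities.\<close>

definition contract :: "(nat \<Rightarrow> nat) \<Rightarrow> nat \<Rightarrow> elt \<Rightarrow> elt" where
  "contract deg x a =
     Poly_Mapping.mapp (\<lambda>n c. koszul_sign deg (mvar x) n * c)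
       (Poly_Mapping.map_key (\<lambda>n. mvar x + n) a)"

lemma lookup_contract:
  "Poly_Mapping.lookup (contract deg x a) n =
     koszul_sign deg (mvar x) n * Poly_Mapping.lookup a (mvar x + n)"
proof -
  have "inj (\<lambda>n. mvar x + n)" by (simp add: inj_def)
  then show ?thesis
    by (auto simp: contract_def lookup_mapp map_key.rep_eq when_def in_keys_iff)
qed

lemma contract_add: "contract deg x (a + b) = contract deg x a + contract deg x b"
  by (intro poly_mapping_eqI) (simp add: lookup_contract lookup_add algebra_simps)

lemma contract_diff: "contract deg x (a - b) = contract deg x a - contract deg x b"
  by (intro poly_mapping_eqI) (simp add: lookup_contract lookup_minus algebra_simps)

lemma contract_scale: "contract deg x (qscale c a) = qscale c (contract deg x a)"
  by (intro poly_mapping_eqI) (simp add: lookup_contract lookup_qscale algebra_simps)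

lemma contract_mem:
  assumes "a \<in> supp_on P"
    and "\<And>n. koszul_sign deg (mvar x) n \<noteq> 0 \<Longrightarrow> mvar x + n \<in> P \<Longrightarrow> n \<in> Q"
  shows "contract deg x a \<in> supp_on Q"
  using assms by (auto simp: supp_on_lookup lookup_contract)

lemma contract_eq_0:
  assumes "a \<in> supp_on P" "\<And>m. m \<in> P \<Longrightarrow> x \<notin> Poly_Mapping.keys m"
  shows "contract deg x a = 0"
proof -
  have "contract deg x a \<in> supp_on {}"
    by (rule contract_mem[OF assms(1)]) (use assms(2) in \<open>force simp: keys_add_nat\<close>)
  then show ?thesis by (auto simp: supp_on_lookup intro: poly_mapping_eqI)
qed

lemma lookup_gmult_gen:
  "Poly_Mapping.lookup (gmult deg (gen x) a) (mvar x + n) =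
     koszul_sign deg (mvar x) n * Poly_Mapping.lookup a n"
  by (induction a rule: elt_induct)
    (auto simp: gmult_single lookup_single gmult_add_right lookup_add algebra_simps when_def)

lemma lookup_gmult_gen_0:
  "x \<notin> Poly_Mapping.keys m \<Longrightarrow> Poly_Mapping.lookup (gmult deg (gen x) a) m = 0"
  by (induction a rule: elt_induct)
    (auto simp: gmult_single lookup_single gmult_add_right lookup_add when_def keys_add_nat)

definition basis_bideg :: "nat set \<Rightarrow> (nat \<Rightarrow> nat) \<Rightarrow> int \<Rightarrow> int \<Rightarrow> mono set" where
  "basis_bideg X deg i k =
     {m \<in> basis_monos X deg. int (mono_degree deg m) = i \<and> int (word_length m) = k}"

text \<open>With integer bidegrees the pieces in negative bidegree are simply zero, as the shifts in
  the exact sequence require.\<close>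

definition Lam_bideg :: "nat set \<Rightarrow> (nat \<Rightarrow> nat) \<Rightarrow> int \<Rightarrow> int \<Rightarrow> elt set" where
  "Lam_bideg X deg i k = supp_on (basis_bideg X deg i k)"

lemma Lam_supp_on: "Lam X deg = supp_on (basis_monos X deg)"
  by (simp add: Lam_def supp_on_def)

lemma Lam_bideg_Lam: "a \<in> Lam_bideg X deg i k \<Longrightarrow> a \<in> Lam X deg"
  unfolding Lam_supp_on Lam_bideg_def by (erule supp_on_mono) (auto simp: basis_bideg_def)

lemma basis_monos_mono: "X \<subseteq> Y \<Longrightarrow> basis_monos X deg \<subseteq> basis_monos Y deg"
  by (auto simp: basis_monos_def)

lemma Lam_mono: "a \<in> Lam X deg \<Longrightarrow> X \<subseteq> Y \<Longrightarrow> a \<in> Lam Y deg"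
  unfolding Lam_supp_on using supp_on_mono basis_monos_mono by blast

lemma Lam_bideg_mono: "a \<in> Lam_bideg X deg i k \<Longrightarrow> X \<subseteq> Y \<Longrightarrow> a \<in> Lam_bideg Y deg i k"
  unfolding Lam_bideg_def
  by (erule supp_on_mono) (use basis_monos_mono[of X Y deg] in \<open>auto simp: basis_bideg_def\<close>)

lemma basis_monos_add:
  assumes "m \<in> basis_monos X deg" "n \<in> basis_monos X deg" "koszul_sign deg m n \<noteq> 0"
  shows "m + n \<in> basis_monos X deg"
proof -
  have disj: "x \<notin> Poly_Mapping.keys m \<or> x \<notin> Poly_Mapping.keys n" if "odd (deg x)" for x
    using assms(3) that by (auto simp: koszul_sign_def split: if_splits)
  have "Poly_Mapping.lookup (m + n) x = 1"
    if "x \<in> Poly_Mapping.keys m \<union> Poly_Mapping.keys n" "odd (deg x)" for x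
    using that disj[of x] assms(1,2) unfolding basis_monos_def lookup_add
    by (auto simp: not_in_keys_iff_lookup_eq_zero)
  then show ?thesis using assms(1,2) by (auto simp: basis_monos_def keys_add_nat)
qed

lemma Lam_gmult: "a \<in> Lam X deg \<Longrightarrow> b \<in> Lam X deg \<Longrightarrow> gmult deg a b \<in> Lam X deg"
  unfolding Lam_supp_on by (erule supp_on_gmult) (auto intro: basis_monos_add)

lemma Lam_bideg_gmult:
  "a \<in> Lam_bideg X deg i k \<Longrightarrow> b \<in> Lam_bideg X deg i' k' \<Longrightarrow>
     gmult deg a b \<in> Lam_bideg X deg (i + i') (k + k')"
  unfolding Lam_bideg_def
  by (erule supp_on_gmult) (auto simp: basis_bideg_def intro: basis_monos_add)

lemma mvar_basis: "x \<in> X \<Longrightarrow> mvar x \<in> basis_monos X deg"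
  by (auto simp: basis_monos_def lookup_mvar)

lemma gen_Lam: "x \<in> X \<Longrightarrow> gen x \<in> Lam X deg"
  unfolding Lam_supp_on by (auto intro!: supp_on_single mvar_basis)

lemma gen_Lam_bideg: "x \<in> X \<Longrightarrow> gen x \<in> Lam_bideg X deg (int (deg x)) 1"
  unfolding Lam_bideg_def by (auto intro!: supp_on_single simp: basis_bideg_def mvar_basis)

lemma Lam_induct [consumes 1, case_names zero single add]:
  assumes "a \<in> Lam X deg"
    and "Q 0"
    and "\<And>m c. m \<in> basis_monos X deg \<Longrightarrow> Q (Poly_Mapping.single m c)"
    and "\<And>a b. a \<in> Lam X deg \<Longrightarrow> b \<in> Lam X deg \<Longrightarrow> Q a \<Longrightarrow> Q b \<Longrightarrow> Q (a + b)"
  shows "Q a"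
  using assms supp_on_induct[of a "basis_monos X deg" Q] by (simp add: Lam_supp_on)

lemma single_Lam_bideg:
  "m \<in> basis_monos X deg \<Longrightarrow>
     Poly_Mapping.single m c \<in> Lam_bideg X deg (int (mono_degree deg m)) (int (word_length m))"
  unfolding Lam_bideg_def by (intro supp_on_single) (auto simp: basis_bideg_def)

text \<open>The elements of \<open>Lam X deg\<close> supported here form the ideal generated by the
  generators of degree below \<open>n\<close>.\<close>

definition low_monos :: "(nat \<Rightarrow> nat) \<Rightarrow> nat \<Rightarrow> mono set" where
  "low_monos deg n = {m. \<exists>y\<in>Poly_Mapping.keys m. deg y < n}"

section \<open>Complexes graded by degree and word-length\<close>

text \<open>
  The derivation property is only needed modulo the ideal generated by the generators of lower
  degree, and this weak form passes to quotients by cocycle generators.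
\<close>

locale word_complex =
  fixes X :: "nat set" and deg :: "nat \<Rightarrow> nat" and d :: "elt \<Rightarrow> elt" and s :: int
  assumes finite_X: "finite X"
    and deg_ge_2: "x \<in> X \<Longrightarrow> 2 \<le> deg x"
    and s_ge_1: "1 \<le> s"
    and d_add: "a \<in> Lam X deg \<Longrightarrow> b \<in> Lam X deg \<Longrightarrow> d (a + b) = d a + d b"
    and d_scale: "a \<in> Lam X deg \<Longrightarrow> d (qscale c a) = qscale c (d a)"
    and d_bideg: "a \<in> Lam_bideg X deg i k \<Longrightarrow> d a \<in> Lam_bideg X deg (i + 1) (k + s)"
    and d_d: "a \<in> Lam X deg \<Longrightarrow> d (d a) = 0"
    and d_gen: "x \<in> X \<Longrightarrow> a \<in> Lam X deg \<Longrightarrow>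
      d (gmult deg (gen x) a) - qscale ((- 1) ^ deg x) (gmult deg (gen x) (d a))
        \<in> supp_on (low_monos deg (deg x))"
begin

abbreviation coh :: "int \<Rightarrow> int \<Rightarrow> bool" where
  "coh \<equiv> nonzero_coh (Lam_bideg X deg) d s"

lemma d_zero [simp]: "d 0 = 0"
  using d_scale[of 0 0] by (simp add: Lam_supp_on)

lemma d_uminus: "a \<in> Lam X deg \<Longrightarrow> d (- a) = - d a"
  using d_scale[of a "-1"] by simp

lemma d_diff: "a \<in> Lam X deg \<Longrightarrow> b \<in> Lam X deg \<Longrightarrow> d (a - b) = d a - d b"
  using d_add[of a "- b"] d_uminus[of b] by (simp add: Lam_supp_on supp_on_uminus)

lemma d_Lam: "a \<in> Lam X deg \<Longrightarrow> d a \<in> Lam X deg"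
proof (induction a rule: Lam_induct)
  case (single m c)
  then show ?case using d_bideg[OF single_Lam_bideg] Lam_bideg_Lam by blast
qed (auto simp: d_add Lam_supp_on supp_on_add)

sublocale complex: bigraded_complex "Lam_bideg X deg" d s
  by unfold_locales
    (auto simp: d_bideg d_diff[OF Lam_bideg_Lam Lam_bideg_Lam] d_d[OF Lam_bideg_Lam],
      auto simp: Lam_bideg_def supp_on_diff)

lemma coh_nonneg: "coh i k \<Longrightarrow> 0 \<le> i \<and> 0 \<le> k"
proof -
  assume "coh i k"
  then obtain z where z: "z \<in> Lam_bideg X deg i k" "z \<notin> d ` Lam_bideg X deg (i - 1) (k - s)"
    unfolding nonzero_coh_def by auto
  have "z \<noteq> 0" using z(2) complex.zero_mem d_zero by force
  then obtain m where "m \<in> Poly_Mapping.keys z" by (metis all_not_in_conv keys_eq_empty)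
  then have "m \<in> basis_bideg X deg i k" using z(1) by (auto simp: Lam_bideg_def supp_on_def)
  then show ?thesis by (auto simp: basis_bideg_def)
qed

end

section \<open>The exact sequence of a cocycle generator\<close>

text \<open>
  Division by the cocycle \<open>v = gen x + v'\<close>, identifying the quotient with the free algebra on
  the remaining generators.  Multiplication by \<open>v\<close> is injective on \<open>\<Lambda>V\<close> if \<open>deg x\<close> is even;
  if it is odd, its kernel is its image, and \<open>v \<Lambda>V\<close> is a shifted copy of the quotient.
\<close>

locale reduction = word_complex +
  fixes x :: nat and v' :: elt
  assumes x_mem: "x \<in> X"
    and v'_mem: "v' \<in> Lam_bideg (X - {x}) deg (int (deg x)) 1"
    and v'_even: "even (deg x) \<Longrightarrow> v' = 0"
    and d_v: "a \<in> Lam X deg \<Longrightarrow>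
      d (gmult deg (gen x + v') a) = qscale ((- 1) ^ deg x) (gmult deg (gen x + v') (d a))"
begin

abbreviation "v \<equiv> gen x + v'"
abbreviation "X' \<equiv> X - {x}"
text \<open>The generators of the algebra B of the exact sequence: on it multiplication by
  \<open>v\<close> is injective, and the image is the kernel of \<open>proj\<close>.\<close>

abbreviation "Y \<equiv> (if odd (deg x) then X' else X)"

text \<open>The substitution of \<open>- v'\<close> for \<open>gen x\<close>, which is the quotient
  map modulo \<open>v\<close>.\<close>

definition proj :: "elt \<Rightarrow> elt" where
  "proj a = keep {m. x \<notin> Poly_Mapping.keys m} a - gmult deg v' (contract deg x a)"

definition d' :: "elt \<Rightarrow> elt" where "d' a = proj (d a)"
text \<open>The sign makes multiplication by an odd \<open>v\<close> a chain map, since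
  \<open>d\<close> anticommutes with it.\<close>

definition dY :: "elt \<Rightarrow> elt" where "dY a = (if odd (deg x) then - d' a else d a)"

lemma proj_add: "proj (a + b) = proj a + proj b"
  by (simp add: proj_def keep_add contract_add gmult_add_right)

lemma proj_diff: "proj (a - b) = proj a - proj b"
  by (simp add: proj_def keep_diff contract_diff gmult_diff_right)

lemma proj_scale: "proj (qscale c a) = qscale c (proj a)"
  by (simp add: proj_def keep_scale contract_scale gmult_scale_right elt.scale_right_diff_distrib)

lemma proj_zero [simp]: "proj 0 = 0"
  using proj_diff[of 0 0] by simp

lemma X'_Lam: "a \<in> Lam X' deg \<Longrightarrow> a \<in> Lam X deg"
  by (rule Lam_mono) auto

lemma Y_Lam: "a \<in> Lam Y deg \<Longrightarrow> a \<in> Lam X deg"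
  by (rule Lam_mono) (auto split: if_splits)

lemma v'_Lam: "v' \<in> Lam X' deg"
  using v'_mem by (rule Lam_bideg_Lam)

lemma v_bideg: "v \<in> Lam_bideg X deg (int (deg x)) 1"
  using gen_Lam_bideg[OF x_mem, of deg] Lam_bideg_mono[OF v'_mem, of X]
  by (auto simp: Lam_bideg_def intro: supp_on_add)

lemma v_linear: "v \<in> supp_on {m. word_length m = 1 \<and> mono_degree deg m = deg x}"
  using v_bideg unfolding Lam_bideg_def by (rule supp_on_mono) (auto simp: basis_bideg_def)

lemma v_Lam: "v \<in> Lam X deg"
  using v_bideg by (rule Lam_bideg_Lam)

lemma contract_basis:
  assumes "koszul_sign deg (mvar x) n \<noteq> 0" "mvar x + n \<in> basis_monos X deg"
  shows "n \<in> basis_monos Y deg"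
proof -
  have "Poly_Mapping.lookup n y = 1" if "y \<in> Poly_Mapping.keys n" "odd (deg y)" for y
  proof -
    have "Poly_Mapping.lookup (mvar x + n) y = 1"
      using assms(2) that by (auto simp: basis_monos_def keys_add_nat)
    then show ?thesis using that(1) by (auto simp: lookup_add in_keys_iff)
  qed
  then show ?thesis using assms
    by (auto simp: basis_monos_def keys_add_nat koszul_sign_mvar split: if_splits)
qed

lemma contract_bideg:
  "a \<in> Lam_bideg X deg i k \<Longrightarrow> contract deg x a \<in> Lam_bideg Y deg (i - int (deg x)) (k - 1)"
  unfolding Lam_bideg_def
  by (erule contract_mem) (use contract_basis in \<open>auto simp: basis_bideg_def\<close>)

lemma contract_Lam: "a \<in> Lam X deg \<Longrightarrow> contract deg x a \<in> Lam Y deg"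
  unfolding Lam_supp_on by (erule contract_mem) (use contract_basis in auto)

lemma v'_contract: "a \<in> Lam Y deg \<Longrightarrow> gmult deg v' a \<in> Lam X' deg"
  using Lam_gmult[OF v'_Lam] v'_even by (cases "odd (deg x)") (auto simp: Lam_supp_on)

lemma v'_contract_bideg:
  "a \<in> Lam_bideg Y deg (i - int (deg x)) (k - 1) \<Longrightarrow> gmult deg v' a \<in> Lam_bideg X' deg i k"
  using Lam_bideg_gmult[OF v'_mem, of a "i - int (deg x)" "k - 1"] v'_even
  by (cases "odd (deg x)") (auto simp: Lam_bideg_def)

lemma proj_bideg: "a \<in> Lam_bideg X deg i k \<Longrightarrow> proj a \<in> Lam_bideg X' deg i k"
  using v'_contract_bideg[OF contract_bideg, of a i k]
  unfolding proj_def Lam_bideg_def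
  by (intro supp_on_diff, elim keep_mem) (auto simp: basis_bideg_def basis_monos_def)

lemma proj_Lam: "a \<in> Lam X deg \<Longrightarrow> proj a \<in> Lam X' deg"
  using v'_contract[OF contract_Lam, of a]
  unfolding proj_def Lam_supp_on
  by (intro supp_on_diff, elim keep_mem) (auto simp: basis_monos_def)

lemma keep_contract:
  assumes "a \<in> Lam X deg"
  shows "a = keep {m. x \<notin> Poly_Mapping.keys m} a + gmult deg (gen x) (contract deg x a)"
proof (rule poly_mapping_eqI)
  fix m
  show "Poly_Mapping.lookup a m = Poly_Mapping.lookup
     (keep {m. x \<notin> Poly_Mapping.keys m} a + gmult deg (gen x) (contract deg x a)) m"
  proof (cases "x \<in> Poly_Mapping.keys m")
    case True
    then obtain n where n: "m = mvar x + n" by (rule mvar_split)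
    \<comment> \<open>A zero sign means that \<open>x\<close> is odd and occurs twice in
      \<open>m\<close>, so \<open>m\<close> is not a basis monomial.\<close>
    have *: "Poly_Mapping.lookup a m = 0" if "koszul_sign deg (mvar x) n = 0"
    proof -
      have "x \<in> Poly_Mapping.keys n" "odd (deg x)"
        using that by (auto simp: koszul_sign_mvar split: if_splits)
      then have "m \<notin> basis_monos X deg"
        using n by (auto simp: basis_monos_def keys_add_nat lookup_add lookup_mvar in_keys_iff)
      then show ?thesis using assms by (auto simp: Lam_supp_on supp_on_lookup)
    qed
    show ?thesis
    proof (cases "koszul_sign deg (mvar x) n = 0")
      case True then show ?thesis
        using * n by (simp add: lookup_add lookup_keep lookup_gmult_gen keys_add_nat)
    next
      case False
      from koszul_sign_mvar_sq[OF this] show ?thesis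
        using n by (simp add: lookup_add lookup_keep lookup_gmult_gen keys_add_nat lookup_contract
          flip: mult.assoc)
    qed
  qed (simp add: lookup_add lookup_keep lookup_gmult_gen_0)
qed

text \<open>Division with remainder: in \<open>keep_contract\<close> the factor \<open>gen x\<close>
  is rewritten as \<open>v - v'\<close>.\<close>

lemma proj_decomp: "a \<in> Lam X deg \<Longrightarrow> a = proj a + gmult deg v (contract deg x a)"
  using keep_contract[of a] by (simp add: proj_def gmult_add_left algebra_simps)

lemma proj_id: "a \<in> Lam X' deg \<Longrightarrow> proj a = a"
  unfolding proj_def Lam_supp_on
  by (subst contract_eq_0, assumption)
    (auto intro!: keep_id elim: supp_on_mono simp: basis_monos_def)

text \<open>The product with \<open>v'\<close> does not involve \<open>x\<close>, so only the
  product with \<open>gen x\<close> is contracted, and there the two signs cancel.\<close>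

lemma contract_v:
  assumes "b \<in> Lam Y deg"
  shows "contract deg x (gmult deg v b) = b"
proof -
  have "contract deg x (gmult deg v' b) = 0"
    using v'_contract[OF assms] unfolding Lam_supp_on
    by (rule contract_eq_0) (auto simp: basis_monos_def)
  moreover have "contract deg x (gmult deg (gen x) b) = b"
  proof (rule poly_mapping_eqI)
    fix n
    have "Poly_Mapping.lookup b n = 0" if "koszul_sign deg (mvar x) n = 0"
    proof -
      have "x \<in> Poly_Mapping.keys n" "odd (deg x)"
        using that by (auto simp: koszul_sign_mvar split: if_splits)
      then show ?thesis
        using assms by (auto simp: Lam_supp_on supp_on_lookup basis_monos_def)
    qed
    then show "Poly_Mapping.lookup (contract deg x (gmult deg (gen x) b)) n = Poly_Mapping.lookup b n"
      using koszul_sign_mvar_sq[of deg x n]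
      by (cases "koszul_sign deg (mvar x) n = 0")
        (auto simp: lookup_contract lookup_gmult_gen simp flip: mult.assoc)
  qed
  ultimately show ?thesis by (simp add: gmult_add_left contract_add)
qed

lemma proj_v_Y:
  assumes "b \<in> Lam Y deg"
  shows "proj (gmult deg v b) = 0"
proof -
  have "keep {m. x \<notin> Poly_Mapping.keys m} (gmult deg (gen x) b) = 0"
    by (intro poly_mapping_eqI) (simp add: lookup_keep lookup_gmult_gen_0 when_def)
  moreover have "keep {m. x \<notin> Poly_Mapping.keys m} (gmult deg v' b) = gmult deg v' b"
    using v'_contract[OF assms] unfolding Lam_supp_on
    by (intro keep_id) (auto elim!: supp_on_mono simp: basis_monos_def)
  ultimately show ?thesis
    unfolding proj_def contract_v[OF assms] by (simp add: gmult_add_left keep_add)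
qed

lemma v_v: "odd (deg x) \<Longrightarrow> gmult deg v (gmult deg v a) = 0"
  by (rule gmult_odd_linear_square[OF v_linear])

text \<open>The difference of \<open>b\<close> and \<open>proj b\<close> is a multiple of
  \<open>v\<close>, which an odd \<open>v\<close> annihilates.\<close>

lemma v_proj:
  assumes "b \<in> Lam X deg" "odd (deg x)"
  shows "gmult deg v b = gmult deg v (proj b)"
  using arg_cong[OF proj_decomp[OF assms(1)], of "gmult deg v"] v_v[OF assms(2)]
  by (simp add: gmult_add_right)

lemma proj_v:
  assumes "b \<in> Lam X deg"
  shows "proj (gmult deg v b) = 0"
  using proj_v_Y[of b] proj_v_Y[of "proj b"] v_proj[OF assms] proj_Lam[OF assms] assms
  by (cases "odd (deg x)") auto

lemma v_mem_Lam: "a \<in> Lam X deg \<Longrightarrow> gmult deg v a \<in> Lam X deg"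
  by (rule Lam_gmult[OF v_Lam])

text \<open>In the division with remainder, \<open>d\<close> sends the multiple of \<open>v\<close>
  to a multiple of \<open>v\<close>, which \<open>proj\<close> kills.\<close>

lemma proj_d:
  assumes "a \<in> Lam X deg"
  shows "proj (d a) = d' (proj a)"
proof -
  have c: "contract deg x a \<in> Lam X deg" using contract_Lam[OF assms] Y_Lam by blast
  have "d a = d (proj a) + d (gmult deg v (contract deg x a))"
    using arg_cong[OF proj_decomp[OF assms], of d]
      d_add[OF X'_Lam[OF proj_Lam[OF assms]] v_mem_Lam[OF c]] by simp
  then show ?thesis
    by (simp add: d_v[OF c] proj_add proj_scale proj_v[OF d_Lam[OF c]] d'_def)
qed

text \<open>The remaining generators commute with \<open>v\<close> up to sign, so they preserve the
  multiples of \<open>v\<close>. This carries the derivation rule to the quotient.\<close>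

lemma proj_gen:
  assumes "y \<in> X'" "b \<in> Lam X deg"
  shows "proj (gmult deg (gen y) b) = gmult deg (gen y) (proj b)"
proof -
  have c: "contract deg x b \<in> Lam X deg" using contract_Lam[OF assms(2)] Y_Lam by blast
  have y: "gen y \<in> Lam X deg" "gen y \<in> Lam X' deg" using assms gen_Lam by auto
  have "gmult deg (gen y) b = gmult deg (gen y) (proj b)
      + gmult deg (gen y) (gmult deg v (contract deg x b))"
    using arg_cong[OF proj_decomp[OF assms(2)], of "gmult deg (gen y)"]
    by (simp add: gmult_add_right)
  then show ?thesis
    using proj_id[OF Lam_gmult[OF y(2) proj_Lam[OF assms(2)]]]
    by (simp add: gmult_linear_commute[OF v_linear] proj_add proj_scale
        proj_v[OF Lam_gmult[OF y(1) c]])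
qed

text \<open>The substitution replaces \<open>x\<close> by generators of the same degree, so a factor
  of degree below \<open>n\<close> never disappears.\<close>

lemma proj_low:
  assumes "a \<in> supp_on (low_monos deg n)"
  shows "proj a \<in> supp_on (low_monos deg n)"
proof -
  have "keep {m. x \<notin> Poly_Mapping.keys m} a \<in> supp_on (low_monos deg n)"
    using assms by (rule keep_mem) auto
  moreover have "contract deg x a \<in> supp_on {m. mvar x + m \<in> low_monos deg n}"
    using assms by (rule contract_mem) auto
  then have "gmult deg v' (contract deg x a) \<in> supp_on (low_monos deg n)"
  proof (rule supp_on_gmult[rotated])
    show "v' \<in> supp_on (basis_bideg X' deg (int (deg x)) 1)"
      using v'_mem by (simp add: Lam_bideg_def)
    fix m k assume m: "m \<in> basis_bideg X' deg (int (deg x)) 1"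
      and k: "k \<in> {m. mvar x + m \<in> low_monos deg n}"
    have "word_length m = 1" using m by (simp add: basis_bideg_def)
    then obtain y where "m = mvar y" by (rule word_length_eq_1)
    moreover from this have "deg y = deg x" using m by (simp add: basis_bideg_def)
    ultimately show "m + k \<in> low_monos deg n"
      using k by (auto simp: low_monos_def keys_add_nat)
  qed
  ultimately show ?thesis unfolding proj_def by (rule supp_on_diff)
qed

sublocale quotient: word_complex X' deg d' s
proof
  show "finite X'" using finite_X by simp
  show "1 \<le> s" by (rule s_ge_1)
  show "2 \<le> deg y" if "y \<in> X'" for y using deg_ge_2 that by simp
  show "d' (a + b) = d' a + d' b" if "a \<in> Lam X' deg" "b \<in> Lam X' deg" for a b
    using that X'_Lam by (simp add: d'_def d_add proj_add)
  show "d' (qscale c a) = qscale c (d' a)" if "a \<in> Lam X' deg" for a c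
    using that X'_Lam by (simp add: d'_def d_scale proj_scale)
  show "d' a \<in> Lam_bideg X' deg (i + 1) (k + s)" if "a \<in> Lam_bideg X' deg i k" for a i k
    unfolding d'_def using Lam_bideg_mono[OF that] by (auto intro!: proj_bideg d_bideg)
  show "d' (d' a) = 0" if "a \<in> Lam X' deg" for a
    using proj_d[OF d_Lam[OF X'_Lam[OF that]]] d_d[OF X'_Lam[OF that]] by (simp add: d'_def)
  \<comment> \<open>This is the image under \<open>proj\<close> of the same rule for
    \<open>d\<close>, with \<open>proj_low\<close> controlling the error term.\<close>
  show "d' (gmult deg (gen y) a) - qscale ((- 1) ^ deg y) (gmult deg (gen y) (d' a))
      \<in> supp_on (low_monos deg (deg y))" if "y \<in> X'" "a \<in> Lam X' deg" for y a
  proof -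
    have a: "a \<in> Lam X deg" using X'_Lam that by blast
    show ?thesis
      using proj_low[OF d_gen[of y a]] that a d_Lam
      by (simp add: proj_diff proj_scale proj_gen d'_def)
  qed
qed

sublocale ses: short_exact_sequence "Lam_bideg X deg" "Lam_bideg Y deg" "Lam_bideg X' deg"
  d dY d' s "gmult deg v" proj "int (deg x)"
proof
  fix i k :: int
  show "0 \<in> Lam_bideg Y deg i k" by (simp add: Lam_bideg_def)
  show "a - b \<in> Lam_bideg Y deg i k"
    if "a \<in> Lam_bideg Y deg i k" "b \<in> Lam_bideg Y deg i k" for a b
    using that by (simp only: Lam_bideg_def supp_on_diff)
  have uminus: "- a \<in> Lam_bideg X' deg i k" if "a \<in> Lam_bideg X' deg i k" for a i k
    using that by (simp only: Lam_bideg_def supp_on_uminus)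
  show "dY a \<in> Lam_bideg Y deg (i + 1) (k + s)" if "a \<in> Lam_bideg Y deg i k" for a
    using that d_bideg[of a i k] quotient.d_bideg[of a i k] uminus
    by (cases "odd (deg x)") (auto simp: dY_def)
  show "dY (a - b) = dY a - dY b"
    if "a \<in> Lam_bideg Y deg i k" "b \<in> Lam_bideg Y deg i k" for a b
    using that complex.d_diff[of a i k b] quotient.complex.d_diff[of a i k b]
    by (cases "odd (deg x)") (auto simp: dY_def)
  show "dY (dY a) = 0" if "a \<in> Lam_bideg Y deg i k" for a
    using that complex.d_d[of a i k] quotient.complex.d_d[of a i k]
      quotient.d_uminus[OF quotient.d_Lam[OF Lam_bideg_Lam[of a X' deg i k]]]
    by (cases "odd (deg x)") (auto simp: dY_def)
  show "gmult deg v b \<in> Lam_bideg X deg (i + int (deg x)) (k + 1)"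
    if "b \<in> Lam_bideg Y deg i k" for b
    using Lam_bideg_gmult[OF v_bideg, of b i k] Lam_bideg_mono[OF that, of X]
    by (simp add: add.commute)
  show "b = 0" if "b \<in> Lam_bideg Y deg i k" "gmult deg v b = 0" for b
    using contract_v[OF Lam_bideg_Lam[OF that(1)]] that(2)
    by (metis contract_scale elt.scale_zero_left)
  \<comment> \<open>For odd \<open>v\<close>, \<open>v_proj\<close> allows \<open>d b\<close> to be
    replaced by its remainder \<open>d' b\<close>.\<close>
  show "d (gmult deg v b) = gmult deg v (dY b)" if "b \<in> Lam_bideg Y deg i k" for b
  proof -
    have b: "b \<in> Lam X deg" using that Lam_bideg_Lam Y_Lam by blast
    show ?thesis
      using v_proj[OF d_Lam[OF b]]
      by (simp add: d_v[OF b] dY_def d'_def gmult_minus_right)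
  qed
  show "\<exists>a\<in>Lam_bideg X deg i k. proj a = c" if "c \<in> Lam_bideg X' deg i k" for c
    using proj_id[OF Lam_bideg_Lam[OF that]] Lam_bideg_mono[OF that, of X] by blast
  show "proj (d a) = d' (proj a)" if "a \<in> Lam_bideg X deg i k" for a
    using proj_d Lam_bideg_Lam[OF that] by blast
  show "proj (gmult deg v b) = 0" if "b \<in> Lam_bideg Y deg i k" for b
    using proj_v_Y Lam_bideg_Lam[OF that] by blast
  show "\<exists>b\<in>Lam_bideg Y deg (i - int (deg x)) (k - 1). a = gmult deg v b"
    if "a \<in> Lam_bideg X deg i k" "proj a = 0" for a
    using proj_decomp[OF Lam_bideg_Lam[OF that(1)]] contract_bideg[OF that(1)] that(2) by auto
qed (simp_all add: gmult_diff_right proj_diff proj_bideg)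

text \<open>Changing the sign of a differential changes neither cocycles nor coboundaries.\<close>

lemma coh_Y_odd:
  assumes "odd (deg x)"
  shows "nonzero_coh (Lam_bideg Y deg) dY s = quotient.coh"
proof -
  have im: "dY ` Lam_bideg X' deg i k = d' ` Lam_bideg X' deg i k" for i k
  proof -
    have "dY a = d' (- a)" "- a \<in> Lam_bideg X' deg i k" if "a \<in> Lam_bideg X' deg i k" for a
      using that assms quotient.d_uminus[OF Lam_bideg_Lam[OF that]]
      by (simp_all add: dY_def Lam_bideg_def supp_on_uminus)
    then show ?thesis by (force simp: image_iff)
  qed
  show ?thesis
    using assms im by (intro ext) (simp add: nonzero_coh_def dY_def)
qed

lemma coh_Y_even: "even (deg x) \<Longrightarrow> nonzero_coh (Lam_bideg Y deg) dY s = coh"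
  by (intro ext) (simp add: nonzero_coh_def dY_def)

end

section \<open>Induction on the number of generators\<close>

lemma (in reduction) gapless_reduction:
  assumes g: "gapless quotient.coh e" and bnd: "\<And>i k. coh i k \<Longrightarrow> k \<le> M"
  shows "gapless coh (if odd (deg x) then e + 1 else e + s - 1)"
proof (cases "odd (deg x)")
  case True
  have n: "2 \<le> int (deg x)" using deg_ge_2[OF x_mem] by simp
  have "gapless coh (e + 1)"
    by (rule gapless_odd_step[OF _ _ _ g s_ge_1 n])
      (use ses.exact_middle ses.exact_quotient' ses.exact_sub' coh_Y_odd[OF True] in \<open>metis\<close>)+
  then show ?thesis using True by simp
next
  case False
  have n: "2 \<le> int (deg x)" using deg_ge_2[OF x_mem] by simp
  have "coh i k \<Longrightarrow> 0 \<le> i \<and> 0 \<le> k \<and> k \<le> M" for i k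
    using coh_nonneg bnd by blast
  moreover have Y: "nonzero_coh (Lam_bideg Y deg) dY s = coh" using coh_Y_even False by blast
  ultimately have "gapless coh (e + s - 1)"
    using ses.exact_middle ses.exact_quotient' ses.exact_sub' unfolding Y
    by (intro gapless_even_step[OF _ _ _ g s_ge_1 n]) blast+
  then show ?thesis using False by simp
qed

text \<open>A class of the quotient lifts, or its connecting target is nonzero at word-length at
  least \<open>k\<close>. For even \<open>x\<close> that target belongs to the given algebra; for
  odd \<open>x\<close> it belongs to the quotient in smaller degree, and induction on the degree
  applies.\<close>

lemma (in reduction) quotient_bounded:
  assumes bnd: "\<And>i k. coh i k \<Longrightarrow> k \<le> M" and "quotient.coh i k"
  shows "k \<le> M"
proof (cases "odd (deg x)")
  case True
  have n: "2 \<le> int (deg x)" using deg_ge_2[OF x_mem] by simp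
  from assms(2) show ?thesis
  proof (induction "nat i" arbitrary: i k rule: less_induct)
    case less
    consider "coh i k" | "quotient.coh (i + 1 - int (deg x)) (k + s - 1)"
      using ses.exact_quotient'[OF less.prems] unfolding coh_Y_odd[OF True] by blast
    then show ?case
    proof cases
      case 1 then show ?thesis by (rule bnd)
    next
      case 2
      have "nat (i + 1 - int (deg x)) < nat i"
        using quotient.coh_nonneg[OF 2] quotient.coh_nonneg[OF less.prems] n by linarith
      from less.hyps[OF this 2] show ?thesis using s_ge_1 by linarith
    qed
  qed
next
  case False
  then have "coh i k \<or> coh (i + 1 - int (deg x)) (k + s - 1)"
    using ses.exact_quotient'[OF assms(2)] coh_Y_even by metis
  then show ?thesis using bnd[of i k] bnd[of "i + 1 - int (deg x)" "k + s - 1"] s_ge_1 by linarith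
qed

text \<open>Each odd generator raises the maximal word-length by 1 and each even one by
  \<open>s - 1\<close>.\<close>

lemma word_complex_gapless:
  assumes "word_complex X deg d s"
    and "\<And>i k. nonzero_coh (Lam_bideg X deg) d s i k \<Longrightarrow> k \<le> M"
  shows "gapless (nonzero_coh (Lam_bideg X deg) d s)
    (int (card {x \<in> X. odd (deg x)}) + (s - 1) * int (card {x \<in> X. even (deg x)}))"
  using assms
proof (induction "card X" arbitrary: X d)
  case 0
  interpret word_complex X deg d s by fact
  have X: "X = {}" using 0 finite_X by simp
  have basis: "basis_monos {} deg = {0}" by (auto simp: basis_monos_def)
  \<comment> \<open>The only nonzero piece has bidegree (0, 0), and \<open>d\<close> would send it
    to word-length \<open>s > 0\<close>.\<close>
  have d0: "d a = 0" if "a \<in> Lam_bideg X deg i k" for a i k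
  proof (cases "i = 0 \<and> k = 0")
    case True
    have "basis_bideg X deg (i + 1) (k + s) = {}"
      using True by (auto simp: basis_bideg_def X basis)
    then show ?thesis using d_bideg[OF that] by (simp add: Lam_bideg_def supp_on_def)
  next
    case False
    have "basis_bideg X deg i k = {}"
      using False by (auto simp: basis_bideg_def X basis)
    then show ?thesis using that by (simp add: Lam_bideg_def supp_on_def)
  qed
  have "coh i k \<longleftrightarrow> i = 0 \<and> k = 0" for i k
  proof
    assume "coh i k"
    then obtain z where z: "z \<in> Lam_bideg X deg i k" "z \<notin> d ` Lam_bideg X deg (i - 1) (k - s)"
      unfolding nonzero_coh_def by auto
    have "z \<noteq> 0" using z(2) complex.zero_mem d_zero by force
    then obtain m where "m \<in> Poly_Mapping.keys z" by (metis all_not_in_conv keys_eq_empty)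
    then have "m \<in> basis_bideg X deg i k" using z(1) by (auto simp: Lam_bideg_def supp_on_def)
    then show "i = 0 \<and> k = 0" by (auto simp: basis_bideg_def X basis)
  next
    assume ik: "i = 0 \<and> k = 0"
    let ?z = "Poly_Mapping.single 0 1 :: elt"
    have z: "?z \<in> Lam_bideg X deg i k"
      unfolding Lam_bideg_def
      by (rule supp_on_single) (use ik in \<open>simp add: basis_bideg_def X basis\<close>)
    moreover have "?z \<noteq> 0" by (metis lookup_single_eq lookup_zero zero_neq_one)
    ultimately show "coh i k"
      unfolding nonzero_coh_def using d0[OF z] d0[of _ "i - 1" "k - s"]
      by (intro bexI[OF _ z]) (auto simp del: single_one)
  qed
  then show ?case by (auto simp: gapless_def X)
next
  case (Suc c)
  interpret word_complex X deg d s by fact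
  have "X \<noteq> {}" using Suc.hyps by auto
  \<comment> \<open>For a generator of least degree the ideal of lower generators is zero, so the
    weak derivation rule becomes exact commutation with \<open>d\<close> up to sign.\<close>
  then have "\<exists>x\<in>X. \<forall>y\<in>X. deg x \<le> deg y"
    using finite_X by (meson arg_min_if_finite(1) arg_min_least)
  then obtain x where x: "x \<in> X" "\<And>y. y \<in> X \<Longrightarrow> deg x \<le> deg y" by blast
  interpret reduction X deg d s x 0
  proof
    show "x \<in> X" by fact
    show "0 \<in> Lam_bideg (X - {x}) deg (int (deg x)) 1" by (simp add: Lam_bideg_def)
    show "d (gmult deg (gen x + 0) a) = qscale ((- 1) ^ deg x) (gmult deg (gen x + 0) (d a))"
      if a: "a \<in> Lam X deg" for a
    proof -
      let ?r = "d (gmult deg (gen x) a) - qscale ((- 1) ^ deg x) (gmult deg (gen x) (d a))"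
      have "?r \<in> supp_on (basis_monos X deg)"
        using a gen_Lam[OF x(1), of deg] d_Lam Lam_gmult unfolding Lam_supp_on
        by (intro supp_on_diff supp_on_scale) auto
      moreover have "?r \<in> supp_on (low_monos deg (deg x))" using d_gen[OF x(1) a] .
      moreover have "basis_monos X deg \<inter> low_monos deg (deg x) = {}"
        using x(2) by (force simp: basis_monos_def low_monos_def)
      ultimately have "?r = 0" by (rule supp_on_disjoint)
      then show ?thesis by simp
    qed
  qed simp
  have "card (X - {x}) = c" using Suc.hyps(2) x(1) finite_X by simp
  then have g: "gapless quotient.coh (int (card {y \<in> X - {x}. odd (deg y)})
      + (s - 1) * int (card {y \<in> X - {x}. even (deg y)}))"
    using Suc.hyps(1)[of "X - {x}" d'] quotient.word_complex_axioms
      quotient_bounded[of M] Suc.prems(2) by blast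
  have card_eq: "card {y \<in> X. P y} = card {y \<in> X - {x}. P y} + (if P x then 1 else 0)" for P
  proof -
    have "{y \<in> X. P y} = (if P x then insert x {y \<in> X - {x}. P y} else {y \<in> X - {x}. P y})"
      using x(1) by auto
    then show ?thesis using finite_X by simp
  qed
  have "gapless coh (if odd (deg x) then int (card {y \<in> X - {x}. odd (deg y)})
        + (s - 1) * int (card {y \<in> X - {x}. even (deg y)}) + 1
      else int (card {y \<in> X - {x}. odd (deg y)})
        + (s - 1) * int (card {y \<in> X - {x}. even (deg y)}) + s - 1)"
    using gapless_reduction[OF g, of M] Suc.prems(2) by blast
  then show ?case
    using card_eq[of "\<lambda>y. odd (deg y)"] card_eq[of "\<lambda>y. even (deg y)"]
    by (cases "odd (deg x)") (simp_all add: algebra_simps)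
qed

section \<open>From bidegrees to dimensions of cohomology\<close>

lemma dim_mod_ge:
  assumes "finite S" "S \<subseteq> U" "\<And>c. (\<Sum>s\<in>S. qscale (c s) s) \<in> B \<Longrightarrow> \<forall>s\<in>S. c s = 0"
  shows "enat (card S) \<le> dim_mod B U"
  unfolding dim_mod_def by (rule SUP_upper) (use assms in auto)

context word_complex
begin

text \<open>\<open>d\<close> is homogeneous of bidegree \<open>(1, s)\<close>, so it maps components
  to components.\<close>

lemma keep_d:
  assumes "b \<in> Lam X deg"
  shows "keep (basis_bideg X deg i k) (d b) = d (keep (basis_bideg X deg (i - 1) (k - s)) b)"
  using assms
proof (induction b rule: Lam_induct)
  case (single m c)
  let ?i = "int (mono_degree deg m)" and ?k = "int (word_length m)"
  have m: "Poly_Mapping.single m c \<in> Lam_bideg X deg ?i ?k" by (rule single_Lam_bideg) fact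
  note dm = d_bideg[OF m]
  show ?case
  proof (cases "?i = i - 1 \<and> ?k = k - s")
    case True
    then have eq: "?i = i - 1" "?k = k - s" "i - 1 + 1 = i" "k - s + s = k" by simp_all
    have "d (Poly_Mapping.single m c) \<in> supp_on (basis_bideg X deg i k)"
      using dm unfolding Lam_bideg_def eq .
    moreover have "Poly_Mapping.single m c \<in> supp_on (basis_bideg X deg (i - 1) (k - s))"
      using m unfolding Lam_bideg_def eq .
    ultimately show ?thesis by (simp add: keep_id)
  next
    case False
    then have "keep (basis_bideg X deg i k) (d (Poly_Mapping.single m c)) = 0"
      using dm unfolding Lam_bideg_def by (intro keep_eq_0) (auto simp: basis_bideg_def)
    moreover have "keep (basis_bideg X deg (i - 1) (k - s)) (Poly_Mapping.single m c) = 0"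
      using m False unfolding Lam_bideg_def by (intro keep_eq_0) (auto simp: basis_bideg_def)
    ultimately show ?thesis by simp
  qed
next
  case (add a b)
  have "keep P a \<in> Lam X deg" if "a \<in> Lam X deg" for P a
    using that unfolding Lam_supp_on by (rule keep_mem) auto
  then show ?case using add by (simp add: d_add keep_add)
qed simp

text \<open>Taking a component of an arbitrary primitive links \<open>nonzero_coh\<close>, where
  primitives are homogeneous, with \<open>coboundaries\<close>, where they are not.\<close>

lemma coboundary_bideg:
  assumes "z \<in> Lam_bideg X deg i k" "z \<in> d ` Lam X deg"
  shows "z \<in> d ` Lam_bideg X deg (i - 1) (k - s)"
proof -
  obtain b where b: "b \<in> Lam X deg" "z = d b" using assms(2) by auto
  have "keep (basis_bideg X deg (i - 1) (k - s)) b \<in> Lam_bideg X deg (i - 1) (k - s)"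
    using b(1) unfolding Lam_supp_on Lam_bideg_def by (rule keep_mem) auto
  moreover have "z = d (keep (basis_bideg X deg (i - 1) (k - s)) b)"
    using keep_d[OF b(1), of i k] b(2) assms(1) by (simp add: keep_id Lam_bideg_def)
  ultimately show ?thesis by blast
qed

lemma coboundary_scale:
  assumes "z \<in> Lam X deg" "qscale c z \<in> d ` Lam X deg" "c \<noteq> 0"
  shows "z \<in> d ` Lam X deg"
proof -
  obtain b where b: "b \<in> Lam X deg" "qscale c z = d b" using assms(2) by auto
  have "z = qscale (inverse c) (qscale c z)" using assms(3) by simp
  also have "\<dots> = d (qscale (inverse c) b)" using b by (simp add: d_scale)
  finally show ?thesis using b(1) unfolding Lam_supp_on by (auto intro: supp_on_scale)
qed

lemma coboundary_sum:
  "(\<And>p. p \<in> P \<Longrightarrow> f p \<in> d ` Lam X deg) \<Longrightarrow> (\<Sum>p\<in>P. f p) \<in> d ` Lam X deg"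
proof (induction P rule: infinite_finite_induct)
  case (insert p P)
  have "f p \<in> d ` Lam X deg" "(\<Sum>p\<in>P. f p) \<in> d ` Lam X deg"
    using insert.prems insert.IH by auto
  then obtain a b where ab: "a \<in> Lam X deg" "b \<in> Lam X deg" "f p = d a" "(\<Sum>p\<in>P. f p) = d b"
    by blast
  then have "(\<Sum>p\<in>insert p P. f p) = d (a + b)" using insert.hyps by (simp add: d_add)
  moreover have "a + b \<in> Lam X deg" using ab unfolding Lam_supp_on by (auto intro: supp_on_add)
  ultimately show ?case by blast
qed (auto simp: Lam_supp_on intro!: image_eqI[of _ d 0])

text \<open>Each bihomogeneous component of a cocycle is a cocycle, and here each lies in a bidegree
  without cohomology.\<close>

lemma coboundary_bidegrees:
  assumes z: "z \<in> Lam X deg" "d z = 0"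
    and *: "\<And>m. m \<in> Poly_Mapping.keys z \<Longrightarrow>
      \<not> coh (int (mono_degree deg m)) (int (word_length m))"
  shows "z \<in> d ` Lam X deg"
proof -
  let ?b = "\<lambda>m. (int (mono_degree deg m), int (word_length m))"
  let ?f = "\<lambda>p. keep (basis_bideg X deg (fst p) (snd p)) z"
  let ?P = "?b ` Poly_Mapping.keys z"
  have "z = (\<Sum>p\<in>?P. ?f p)"
  proof (rule poly_mapping_eqI)
    fix m
    have "Poly_Mapping.lookup (\<Sum>p\<in>?P. ?f p) m = (\<Sum>p\<in>?P. if p = ?b m then Poly_Mapping.lookup z m else 0)"
      unfolding lookup_sum
    proof (intro sum.cong refl)
      fix p
      show "Poly_Mapping.lookup (?f p) m = (if p = ?b m then Poly_Mapping.lookup z m else 0)"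
        using z(1) by (cases p) (auto simp: lookup_keep when_def basis_bideg_def Lam_supp_on supp_on_lookup)
    qed
    also have "\<dots> = (if ?b m \<in> ?P then Poly_Mapping.lookup z m else 0)" by simp
    also have "\<dots> = Poly_Mapping.lookup z m" by (auto simp: in_keys_iff image_iff)
    finally show "Poly_Mapping.lookup z m = Poly_Mapping.lookup (\<Sum>p\<in>?P. ?f p) m" by simp
  qed
  moreover have "?f p \<in> d ` Lam X deg" if p: "p \<in> ?P" for p
  proof -
    obtain m where m: "m \<in> Poly_Mapping.keys z" "p = ?b m" using p by auto
    let ?i = "fst p" and ?k = "snd p"
    have "?f p \<in> Lam_bideg X deg ?i ?k"
      using z(1) unfolding Lam_supp_on Lam_bideg_def by (rule keep_mem) auto
    moreover have "d (?f p) = 0"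
      using keep_d[OF z(1), of "?i + 1" "?k + s"] z(2) by simp
    ultimately have "?f p \<in> d ` Lam_bideg X deg (?i - 1) (?k - s)"
      using *[OF m(1)] m(2) unfolding nonzero_coh_def by fastforce
    then show ?thesis using Lam_bideg_Lam by blast
  qed
  ultimately show ?thesis using coboundary_sum[of ?P ?f] by simp
qed

lemma coh_noncoboundary:
  assumes "coh i k"
  obtains z where "z \<in> Lam_bideg X deg i k" "d z = 0" "z \<notin> d ` Lam X deg"
  using assms coboundary_bideg unfolding nonzero_coh_def by blast

text \<open>Cocycles of different word-length representing nonzero classes are independent.\<close>

lemma coh_bounded:
  assumes "dim_cohomology X deg d < \<infinity>"
  shows "\<exists>M. \<forall>i k. coh i k \<longrightarrow> k \<le> M"
proof (rule ccontr)
  assume "\<not> ?thesis"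
  then have unb: "\<exists>i k. coh i k \<and> M < k" for M by (auto simp: not_le)
  obtain N where N: "dim_cohomology X deg d = enat N" using assms by (cases "dim_cohomology X deg d") auto
  define K where "K = {k. \<exists>i. coh i k}"
  have "infinite K"
  proof
    assume "finite K"
    obtain i k where "coh i k" "Max (insert 0 K) < k" using unb by blast
    moreover from this have "k \<in> K" by (auto simp: K_def)
    ultimately show False using \<open>finite K\<close> by (metis Max_ge finite_insert insertCI not_le)
  qed
  \<comment> \<open>One word-length more than the dimension \<open>N\<close> of the cohomology, to
    be contradicted by the independence of the chosen cocycles.\<close>
  then obtain T where T: "T \<subseteq> K" "finite T" "card T = Suc N"
    using infinite_arbitrarily_large by blast
  have "\<forall>k\<in>K. \<exists>i z. z \<in> Lam_bideg X deg i k \<and> d z = 0 \<and> z \<notin> d ` Lam X deg"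
    unfolding K_def using coh_noncoboundary by blast
  then obtain i z where z: "\<And>k. k \<in> K \<Longrightarrow> z k \<in> Lam_bideg X deg (i k) k \<and> d (z k) = 0 \<and>
      z k \<notin> d ` Lam X deg" by metis
  have nz: "z k \<noteq> 0" if "k \<in> K" for k
  proof
    assume "z k = 0"
    then have "z k = d 0" by simp
    moreover have "0 \<in> Lam X deg" by (simp add: Lam_supp_on)
    ultimately show False using z[OF that] by blast
  qed
  have comp: "keep (basis_bideg X deg (i k) k) (z k') = (if k' = k then z k else 0)"
    if "k \<in> K" "k' \<in> K" for k k'
  proof (cases "k' = k")
    case True
    then show ?thesis using z[OF that(1)] by (simp add: keep_id Lam_bideg_def)
  next
    case False
    then show ?thesis
      using z[OF that(2)] unfolding Lam_bideg_def
      by (auto intro!: keep_eq_0[where Q = "basis_bideg X deg (i k') k'"] simp: basis_bideg_def)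
  qed
  have inj: "inj_on z T"
    using comp nz T(1) unfolding inj_on_def by (metis subsetD)
  have keep_sum: "keep P (\<Sum>k\<in>T. f k) = (\<Sum>k\<in>T. keep P (f k))" for P f
    by (induction T rule: infinite_finite_induct) (simp_all add: keep_add)
  have "enat (card (z ` T)) \<le> dim_mod (d ` Lam X deg) (cocycles X deg d)"
  proof (rule dim_mod_ge)
    show "finite (z ` T)" using T by simp
    show "z ` T \<subseteq> cocycles X deg d"
      using z T Lam_bideg_Lam unfolding cocycles_def by blast
    fix c assume "(\<Sum>s\<in>z ` T. qscale (c s) s) \<in> d ` Lam X deg"
    then obtain b where b: "b \<in> Lam X deg" "(\<Sum>k\<in>T. qscale (c (z k)) (z k)) = d b"
      using sum.reindex[OF inj, of "\<lambda>s. qscale (c s) s"] by auto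
    show "\<forall>u\<in>z ` T. c u = 0"
    proof (intro ballI, elim imageE)
      fix u k assume k: "u = z k" "k \<in> T"
      \<comment> \<open>The component in the bidegree of \<open>z k\<close> isolates one term of the
        relation.\<close>
      have "keep (basis_bideg X deg (i k) k) (\<Sum>k\<in>T. qscale (c (z k)) (z k)) =
          (\<Sum>k'\<in>T. if k' = k then qscale (c (z k)) (z k) else 0)"
        unfolding keep_sum using T k
        by (intro sum.cong refl) (auto simp: keep_scale comp subsetD)
      also have "\<dots> = qscale (c (z k)) (z k)" using k T by simp
      finally have "qscale (c (z k)) (z k) = d (keep (basis_bideg X deg (i k - 1) (k - s)) b)"
        using b(2) keep_d[OF b(1), of "i k" k] by simp
      moreover have "keep (basis_bideg X deg (i k - 1) (k - s)) b \<in> Lam X deg"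
        using b(1) unfolding Lam_supp_on by (rule keep_mem) auto
      ultimately have "qscale (c (z k)) (z k) \<in> d ` Lam X deg" by (metis image_eqI)
      then show "c u = 0"
        using coboundary_scale[of "z k" "c (z k)"] z[of k] Lam_bideg_Lam k T(1) by blast
    qed
  qed
  then show False
    using N card_image[OF inj] T(3)
    unfolding dim_cohomology_def coboundaries_def by simp
qed

end

section \<open>Minimal algebras\<close>

lemma independent_gen: "elt.independent (gen ` A)"
  unfolding elt.independent_explicit_module
proof (intro allI impI)
  fix T u v assume T: "finite T" "T \<subseteq> gen ` A" "(\<Sum>v\<in>T. qscale (u v) v) = 0" "v \<in> T"
  obtain x where x: "v = gen x" using T by auto
  have "0 = (\<Sum>w\<in>T. Poly_Mapping.lookup (qscale (u w) w) (mvar x))"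
    using T(3) by (metis lookup_sum lookup_zero)
  also have "\<dots> = (\<Sum>w\<in>T. if w = v then u v else 0)"
    by (rule sum.cong[OF refl]) (use T(2) x in \<open>auto simp: lookup_single when_def\<close>)
  also have "\<dots> = u v" using T by simp
  finally show "u v = 0" by simp
qed

lemma inj_gen: "inj gen"
proof
  fix x y assume "gen x = gen y"
  then have "Poly_Mapping.keys (gen x) = Poly_Mapping.keys (gen y)" by simp
  then show "x = y" by simp
qed

lemma span_gen:
  "elt.span (gen ` {x \<in> X. P x}) = supp_on (mvar ` {x \<in> X. P x})"
proof
  have "elt.subspace (supp_on Q)" for Q
    by (auto simp: elt.subspace_def intro: supp_on_add supp_on_scale)
  moreover have "gen ` {x \<in> X. P x} \<subseteq> supp_on (mvar ` {x \<in> X. P x})"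
    by (auto intro: supp_on_single)
  ultimately show "elt.span (gen ` {x \<in> X. P x}) \<subseteq> supp_on (mvar ` {x \<in> X. P x})"
    by (intro elt.span_minimal)
  show "supp_on (mvar ` {x \<in> X. P x}) \<subseteq> elt.span (gen ` {x \<in> X. P x})"
  proof
    fix a assume "a \<in> supp_on (mvar ` {x \<in> X. P x})"
    then show "a \<in> elt.span (gen ` {x \<in> X. P x})"
    proof (induction a rule: supp_on_induct)
      case (single m c)
      then obtain x where x: "m = mvar x" "x \<in> X" "P x" by auto
      then have "qscale c (gen x) \<in> elt.span (gen ` {x \<in> X. P x})"
        by (intro elt.span_scale elt.span_base) auto
      then show ?case using x by simp
    qed (auto intro: elt.span_zero elt.span_add)
  qed
qed

text \<open>Turns the dimensions in the formula for \<open>e\<close> into numbers of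
  generators.\<close>

lemma dim_span_gen: "elt.dim (supp_on (mvar ` {x \<in> X. P x})) = card {x \<in> X. P x}"
proof -
  have "elt.dim (elt.span (gen ` {x \<in> X. P x})) = card (gen ` {x \<in> X. P x})"
    by (rule elt.dim_span_eq_card_independent[OF independent_gen])
  also have "\<dots> = card {x \<in> X. P x}" using inj_gen by (intro card_image) (simp add: inj_on_def)
  finally show ?thesis by (simp add: span_gen)
qed

lemma basis_word_1:
  "{m \<in> basis_monos X deg. word_length m = 1 \<and> P (mono_degree deg m)} = mvar ` {x \<in> X. P (deg x)}"
proof -
  have "m \<in> mvar ` {x \<in> X. P (deg x)}"
    if m: "m \<in> basis_monos X deg" "word_length m = 1" "P (mono_degree deg m)" for m
  proof -
    obtain x where "m = mvar x" using m(2) by (rule word_length_eq_1)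
    then show ?thesis using m by (auto simp: basis_monos_def)
  qed
  then show ?thesis by (auto simp: mvar_basis)
qed

lemma gens_supp_on: "gens X deg = supp_on (mvar ` {x \<in> X. True})"
  and gens_odd_supp_on: "gens_odd X deg = supp_on (mvar ` {x \<in> X. odd (deg x)})"
  and gens_even_supp_on: "gens_even X deg = supp_on (mvar ` {x \<in> X. even (deg x)})"
  unfolding basis_word_1[of X deg "\<lambda>_. True", symmetric] basis_word_1[of X deg odd, symmetric]
    basis_word_1[of X deg even, symmetric]
  by (auto simp: gens_odd_def gens_even_def Lam_word_def Lam_def supp_on_def)

lemma finite_generators:
  assumes "elliptic X deg d"
  shows "finite X"
proof -
  obtain S where S: "finite S" "gens X deg = elt.span S" using assms by (auto simp: elliptic_def)
  have "gen ` X \<subseteq> elt.span S"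
    unfolding S(2)[symmetric] gens_supp_on by (auto intro!: supp_on_single)
  then have "finite (gen ` X)" using elt.independent_span_bound[OF S(1) independent_gen] by blast
  then show ?thesis using inj_gen by (metis finite_imageD inj_on_subset subset_UNIV)
qed

lemma mono_degree_ge:
  assumes "\<And>x. x \<in> Poly_Mapping.keys m \<Longrightarrow> 2 \<le> deg x"
  shows "2 * word_length m \<le> mono_degree deg m"
  unfolding word_length_def mono_degree_def sum_distrib_left
  by (rule sum_mono) (use assms in \<open>simp add: mult.commute\<close>)

text \<open>After one factor \<open>y\<close> is removed, the rest is nonempty and has degree at
  least 2, which leaves at most \<open>n - 1\<close> for \<open>y\<close>. Applied to the terms of
  the differential of a generator of degree \<open>n\<close>.\<close>

lemma basis_low:
  assumes "\<And>x. x \<in> X \<Longrightarrow> 2 \<le> deg x" "m \<in> basis_monos X deg"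
    and "2 \<le> word_length m" "mono_degree deg m = n + 1"
  shows "m \<in> low_monos deg n"
proof -
  have "m \<noteq> 0" using assms(3) by auto
  then obtain y where y: "y \<in> Poly_Mapping.keys m" by (metis all_not_in_conv keys_eq_empty)
  then obtain k where k: "m = mvar y + k" by (rule mvar_split)
  have "2 * word_length k \<le> mono_degree deg k"
    by (rule mono_degree_ge) (use assms(1,2) k in \<open>auto simp: basis_monos_def keys_add_nat\<close>)
  then have "deg y < n" using assms(3,4) k by simp
  then show ?thesis using y by (auto simp: low_monos_def)
qed

text \<open>Splitting off the smallest generator creates no inversion, so a monomial is a product of
  generators without signs.\<close>

lemma Min_split:
  assumes "m \<in> basis_monos X deg" "m \<noteq> 0"
  obtains x n where "x \<in> X" "m = mvar x + n" "n \<in> basis_monos X deg"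
    "koszul_sign deg (mvar x) n = 1"
proof -
  have ne: "Poly_Mapping.keys m \<noteq> {}" using assms(2) by simp
  define x where "x = Min (Poly_Mapping.keys m)"
  have x: "x \<in> Poly_Mapping.keys m" "\<And>y. y \<in> Poly_Mapping.keys m \<Longrightarrow> x \<le> y"
    using ne by (auto simp: x_def)
  obtain n where n: "m = mvar x + n" using x(1) by (rule mvar_split)
  have y1: "Poly_Mapping.lookup m y = 1" if "y \<in> Poly_Mapping.keys m" "odd (deg y)" for y
    using assms(1) that by (auto simp: basis_monos_def)
  have nx: "x \<notin> Poly_Mapping.keys n" if "odd (deg x)"
    using y1[OF x(1) that] n by (simp add: lookup_add lookup_mvar in_keys_iff)
  have less: "{y \<in> Poly_Mapping.keys n. odd (deg y) \<and> y < x} = {}"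
    using x(2) n by (force simp: keys_add_nat)
  have "koszul_sign deg (mvar x) n = 1" unfolding koszul_sign_mvar less using nx by simp
  moreover have "Poly_Mapping.lookup n y = 1" if "y \<in> Poly_Mapping.keys n" "odd (deg y)" for y
    using y1[of y] that n by (auto simp: keys_add_nat lookup_add in_keys_iff)
  then have "n \<in> basis_monos X deg"
    using assms(1) n by (auto simp: basis_monos_def keys_add_nat)
  ultimately show ?thesis using that n x(1) assms(1) by (auto simp: basis_monos_def)
qed

lemma Lam_deg_supp_on: "Lam_deg X deg i = supp_on {m \<in> basis_monos X deg. mono_degree deg m = i}"
  and Lam_word_supp_on: "Lam_word X deg k = supp_on {m \<in> basis_monos X deg. word_length m = k}"
  by (auto simp: Lam_deg_def Lam_word_def Lam_def supp_on_def)

section \<open>From the minimal algebra to a word complex\<close>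

context minimal_algebra
begin

lemma d_0: "d 0 = 0"
  using d_scale[of 0 0] by (simp add: Lam_supp_on)

text \<open>The image has degree 1, and all generators have degree at least 2.\<close>

lemma d_one: "d (Poly_Mapping.single 0 c) = 0"
proof -
  have "Poly_Mapping.single 0 c \<in> Lam_deg X deg 0"
    unfolding Lam_deg_supp_on by (rule supp_on_single) (simp add: basis_monos_def)
  then have "d (Poly_Mapping.single 0 c) \<in> Lam_deg X deg 1"
    using d_degree[of _ 0] by simp
  moreover have "{m \<in> basis_monos X deg. mono_degree deg m = 1} = {}"
  proof -
    have "mono_degree deg m \<noteq> 1" if "m \<in> basis_monos X deg" for m
    proof -
      have "2 * word_length m \<le> mono_degree deg m"
        by (rule mono_degree_ge) (use that simply_connected in \<open>auto simp: basis_monos_def\<close>)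
      then show ?thesis using word_length_eq_0[of m] by (cases "m = 0") auto
    qed
    then show ?thesis by auto
  qed
  ultimately have "d (Poly_Mapping.single 0 c) \<in> supp_on {}" by (simp only: Lam_deg_supp_on)
  then show ?thesis by (simp add: supp_on_def)
qed

lemma d_gen_mult:
  assumes "x \<in> X" "a \<in> Lam X deg"
  shows "d (gmult deg (gen x) a) =
    gmult deg (d (gen x)) a + qscale ((- 1) ^ deg x) (gmult deg (gen x) (d a))"
  by (rule d_derivation[OF _ assms(2)])
    (use assms(1) in \<open>auto simp: Lam_deg_supp_on mvar_basis intro: supp_on_single\<close>)

text \<open>By the Leibniz rule and induction on word-length, \<open>d\<close> raises word-length by
  \<open>s\<close>, which is \<open>l - 1\<close>.\<close>

lemma d_word_single:
  assumes hom: "homogeneous_length X deg d (Suc s)" and "m \<in> basis_monos X deg"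
  shows "d (Poly_Mapping.single m c) \<in> Lam_word X deg (word_length m + s)"
  using assms(2)
proof (induction "word_length m" arbitrary: m)
  case 0
  then show ?case using word_length_eq_0[of m] by (simp add: d_one Lam_word_supp_on)
next
  case (Suc k)
  then obtain x n where xn: "x \<in> X" "m = mvar x + n" "n \<in> basis_monos X deg"
    "koszul_sign deg (mvar x) n = 1"
    using Min_split[of m X deg] by (metis word_length_0 nat.distinct(1))
  let ?n = "Poly_Mapping.single n c"
  have k: "k = word_length n" using Suc.hyps(2) xn(2) by simp
  have n: "?n \<in> Lam_word X deg k" "?n \<in> Lam X deg"
    using xn(3) k by (auto simp: Lam_word_supp_on Lam_supp_on intro: supp_on_single)
  have g: "gen x \<in> Lam_word X deg 1"
    using xn(1) by (auto simp: Lam_word_supp_on mvar_basis intro: supp_on_single)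
  then have dg: "d (gen x) \<in> Lam_word X deg (Suc s)"
    using hom by (auto simp: homogeneous_length_def)
  have mult: "gmult deg a b \<in> Lam_word X deg (i + j)"
    if "a \<in> Lam_word X deg i" "b \<in> Lam_word X deg j" for a b i j
    using that unfolding Lam_word_supp_on
    by (elim supp_on_gmult) (auto intro: basis_monos_add)
  have "Poly_Mapping.single m c = gmult deg (gen x) ?n" using xn by (simp add: gmult_single)
  then have "d (Poly_Mapping.single m c) =
      gmult deg (d (gen x)) ?n + qscale ((- 1) ^ deg x) (gmult deg (gen x) (d ?n))"
    using d_gen_mult[OF xn(1) n(2)] by simp
  moreover have "gmult deg (d (gen x)) ?n \<in> Lam_word X deg (word_length m + s)"
    using mult[OF dg n(1)] xn(2) k by (simp add: algebra_simps)
  moreover have "gmult deg (gen x) (d ?n) \<in> Lam_word X deg (word_length m + s)"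
    using mult[OF g Suc.hyps(1)[OF k xn(3)]] xn(2) by (simp add: algebra_simps)
  ultimately show ?case unfolding Lam_word_supp_on
    by (metis supp_on_add supp_on_scale)
qed

lemma to_word_complex:
  assumes hom: "homogeneous_length X deg d (Suc s)" and s: "1 \<le> s" and fin: "finite X"
  shows "word_complex X deg d (int s)"
proof
  show "finite X" "1 \<le> int s" using assms by simp_all
  show "2 \<le> deg x" if "x \<in> X" for x by (rule simply_connected[OF that])
  show "d (a + b) = d a + d b" if "a \<in> Lam X deg" "b \<in> Lam X deg" for a b
    by (rule d_add[OF that])
  show "d (qscale c a) = qscale c (d a)" if "a \<in> Lam X deg" for c a by (rule d_scale[OF that])
  show "d (d a) = 0" if "a \<in> Lam X deg" for a by (rule d_squared[OF that])
  show "d a \<in> Lam_bideg X deg (i + 1) (k + int s)" if "a \<in> Lam_bideg X deg i k" for a i k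
    using that unfolding Lam_bideg_def
  proof (induction a rule: supp_on_induct)
    case zero then show ?case by (simp add: d_0)
  next
    case (single m c)
    then have m: "m \<in> basis_monos X deg" "int (mono_degree deg m) = i" "int (word_length m) = k"
      by (auto simp: basis_bideg_def)
    then have "Poly_Mapping.single m c \<in> Lam_deg X deg (mono_degree deg m)"
      by (auto simp: Lam_deg_supp_on intro: supp_on_single)
    from d_degree[OF this] d_word_single[OF hom m(1), of c] show ?case
      using m by (fastforce simp: Lam_deg_supp_on Lam_word_supp_on supp_on_def basis_bideg_def)
  next
    case (add a b)
    have "a \<in> Lam X deg" "b \<in> Lam X deg"
      using add.hyps Lam_bideg_Lam[of _ X deg i k] by (auto simp: Lam_bideg_def)
    then show ?case using add.IH by (simp add: d_add supp_on_add)
  qed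
  show "d (gmult deg (gen x) a) - qscale ((- 1) ^ deg x) (gmult deg (gen x) (d a))
      \<in> supp_on (low_monos deg (deg x))" if x: "x \<in> X" and a: "a \<in> Lam X deg" for x a
  proof -
    have "gen x \<in> Lam_deg X deg (deg x)" "gen x \<in> gens X deg"
      using x by (auto simp: Lam_deg_supp_on Lam_word_supp_on mvar_basis intro: supp_on_single)
    then have dx: "d (gen x) \<in> Lam_deg X deg (deg x + 1)" "d (gen x) \<in> Lam_word X deg (Suc s)"
      using d_degree hom by (auto simp: homogeneous_length_def)
    \<comment> \<open>The first Leibniz term is the error term; decomposability puts it into the
      ideal of lower generators by \<open>basis_low\<close>.\<close>
    have "d (gen x) \<in> supp_on (low_monos deg (deg x))"
      unfolding supp_on_def
    proof (intro CollectI subsetI)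
      fix m assume "m \<in> Poly_Mapping.keys (d (gen x))"
      then show "m \<in> low_monos deg (deg x)"
        using dx s simply_connected
        by (intro basis_low[of X]) (auto simp: Lam_deg_supp_on Lam_word_supp_on supp_on_def)
    qed
    then have "gmult deg (d (gen x)) a \<in> supp_on (low_monos deg (deg x))"
      by (rule supp_on_gmult[where Q = UNIV])
        (auto simp: supp_on_def low_monos_def keys_add_nat)
    then show ?thesis by (simp add: d_gen_mult[OF x a])
  qed
qed

end

section \<open>The Toomer invariant and the two independent classes\<close>

lemma (in word_complex) toomer_eq:
  assumes g: "gapless coh (int e)" and e: "1 \<le> e"
  shows "toomer X deg d = enat e"
proof -
  have inj: "proj_injective X deg d e"
    unfolding proj_injective_def
  proof (intro ballI impI, elim bexE)
    fix z b assume z: "z \<in> cocycles X deg d" and b: "b \<in> Lam X deg"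
      and zb: "z - d b \<in> Lam_word_ge X deg (e + 1)"
    have z': "z \<in> Lam X deg" "d z = 0" using z by (auto simp: cocycles_def)
    \<comment> \<open>All components have word-length above \<open>e\<close>, where cohomology
      vanishes.\<close>
    have "z - d b \<in> d ` Lam X deg"
    proof (rule coboundary_bidegrees)
      show "z - d b \<in> Lam X deg"
        using z' d_Lam[OF b] by (simp add: Lam_supp_on supp_on_diff)
      show "d (z - d b) = 0" using z' d_Lam[OF b] b by (simp add: d_diff d_d)
      show "\<not> coh (int (mono_degree deg m)) (int (word_length m))"
        if "m \<in> Poly_Mapping.keys (z - d b)" for m
        using gapless_range[OF g, of "int (mono_degree deg m)" "int (word_length m)"] zb that
        by (fastforce simp: Lam_word_ge_def)
    qed
    then obtain c where c: "c \<in> Lam X deg" "z - d b = d c" by auto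
    have "z = d (b + c)" using b c by (simp add: d_add algebra_simps flip: c(2))
    then show "z \<in> coboundaries X deg d"
      using b c unfolding coboundaries_def Lam_supp_on by (auto intro: supp_on_add)
  qed
  \<comment> \<open>For \<open>n < e\<close>, a nonzero class of word-length \<open>e\<close>
    becomes zero in the quotient.\<close>
  have "e \<le> n" if n: "proj_injective X deg d n" for n
  proof (rule ccontr)
    assume "\<not> e \<le> n"
    obtain i where "coh i (int e)" using gapless_max[OF g] by auto
    then obtain z where z: "z \<in> Lam_bideg X deg i (int e)" "d z = 0" "z \<notin> d ` Lam X deg"
      by (rule coh_noncoboundary)
    have "z \<in> cocycles X deg d" using z Lam_bideg_Lam by (auto simp: cocycles_def)
    moreover have "z - d 0 \<in> Lam_word_ge X deg (n + 1)"
      using z(1) Lam_bideg_Lam[OF z(1)] \<open>\<not> e \<le> n\<close>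
      by (fastforce simp: Lam_word_ge_def Lam_bideg_def supp_on_def basis_bideg_def)
    moreover have "0 \<in> Lam X deg" by (simp add: Lam_supp_on)
    ultimately have "z \<in> coboundaries X deg d"
      using n unfolding proj_injective_def by blast
    then show False using z(3) by (simp add: coboundaries_def)
  qed
  then show ?thesis
    unfolding toomer_def using inj e by (intro antisym Inf_lower Inf_greatest) auto
qed

text \<open>The two classes are a lift of a class of least degree in the quotient and the product of
  \<open>v\<close> with a class of greatest degree.\<close>

lemma (in reduction) dim_cohomology_word_ge_2:
  assumes odd: "odd (deg x)" and g: "gapless quotient.coh e" and k: "1 \<le> k" "int k \<le> e"
  shows "2 \<le> dim_cohomology_word X deg d k"
proof -
  have n: "2 \<le> int (deg x)" using deg_ge_2[OF x_mem] by simp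
  obtain i where "quotient.coh i (int k)" using gapless_nonempty[OF g, of "int k"] k by auto
  \<comment> \<open>The vanishing connecting target allows the class to be lifted to the cocycle
    \<open>z\<close>.\<close>
  then obtain i where i: "quotient.coh i (int k)"
      "\<not> quotient.coh (i + 1 - int (deg x)) (int k + s - 1)"
    using gapless_bottom[OF g _ s_ge_1 n] by metis
  obtain z where z: "z \<in> Lam_bideg X deg i (int k)" "d z = 0"
      "proj z \<notin> d' ` Lam_bideg X' deg (i - 1) (int k - s)"
    using ses.exact_quotient[OF i(1)] i(2) unfolding coh_Y_odd[OF odd] by blast
  obtain j where "quotient.coh j (int k - 1)"
    using gapless_nonempty[OF g, of "int k - 1"] k by auto
  then obtain j where j: "quotient.coh j (int k - 1)"
      "\<not> quotient.coh (j + int (deg x) - 1) (int k - 1 + 1 - s)"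
    using gapless_top[OF g _ s_ge_1 n] by metis
  obtain b where b: "b \<in> Lam_bideg Y deg j (int k - 1)" "dY b = 0"
      "gmult deg v b \<notin> d ` Lam_bideg X deg (j + int (deg x) - 1) (int k - 1 + 1 - s)"
    using ses.exact_sub[of j "int k - 1"] j unfolding coh_Y_odd[OF odd] by blast
  define w where "w = gmult deg v b"
  have w: "w \<in> Lam_bideg X deg (j + int (deg x)) (int k)"
    using ses.j_mem[OF b(1)] by (simp add: w_def)
  have "d w = 0" using ses.j_d[OF b(1)] b(2) by (simp add: w_def)
  have pw: "proj w = 0" using ses.p_j[OF b(1)] by (simp add: w_def)
  have wn: "w \<notin> d ` Lam X deg"
    using coboundary_bideg[OF w] b(3) by (auto simp: w_def)
  have zn: "proj z \<notin> d' ` Lam X' deg"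
    using quotient.coboundary_bideg[OF proj_bideg[OF z(1)]] z(3) by auto
  have L: "z \<in> Lam X deg" "w \<in> Lam X deg" using z(1) w Lam_bideg_Lam by blast+
  have "proj z \<noteq> 0"
  proof
    assume "proj z = 0"
    then have "proj z = d' 0" by simp
    moreover have "0 \<in> Lam X' deg" by (simp add: Lam_supp_on)
    ultimately show False using zn by blast
  qed
  then have zw: "z \<noteq> w" using pw by auto
  have "enat (card {z, w}) \<le> dim_mod (coboundaries X deg d) (cocycles X deg d \<inter> Lam_word X deg k)"
  proof (rule dim_mod_ge)
    have "z \<in> Lam_word X deg k" "w \<in> Lam_word X deg k"
      using z(1) w by (auto simp: Lam_bideg_def Lam_word_supp_on basis_bideg_def elim!: supp_on_mono)
    then show "{z, w} \<subseteq> cocycles X deg d \<inter> Lam_word X deg k"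
      using L z(2) \<open>d w = 0\<close> by (auto simp: cocycles_def)
    fix c assume "(\<Sum>u\<in>{z, w}. qscale (c u) u) \<in> coboundaries X deg d"
    then obtain a where a: "a \<in> Lam X deg" "qscale (c z) z + qscale (c w) w = d a"
      using zw by (auto simp: coboundaries_def)
    \<comment> \<open>As \<open>proj w = 0\<close>, applying \<open>proj\<close> isolates the
      coefficient of \<open>z\<close>; then only the term in \<open>w\<close> remains.\<close>
    have "qscale (c z) (proj z) = d' (proj a)"
      using arg_cong[OF a(2), of proj] pw proj_d[OF a(1)] by (simp add: proj_add proj_scale)
    then have "qscale (c z) (proj z) \<in> d' ` Lam X' deg" using proj_Lam[OF a(1)] by auto
    then have cz: "c z = 0" using quotient.coboundary_scale[OF proj_Lam[OF L(1)]] zn by blast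
    then have "qscale (c w) w \<in> d ` Lam X deg" using a by auto
    then have "c w = 0" using coboundary_scale[OF L(2)] wn by blast
    then show "\<forall>u\<in>{z, w}. c u = 0" using cz by simp
  qed simp
  then show ?thesis
    using zw unfolding dim_cohomology_word_def by (simp add: numeral_eq_enat eval_nat_numeral)
qed

text \<open>The cocycle may mix generators of several degrees. Its component in the degree of one
  occurring generator is again a cocycle.\<close>

lemma (in minimal_algebra) odd_cocycle_reduction:
  assumes "word_complex X deg d s" and v0: "v0 \<in> gens_odd X deg" "v0 \<noteq> 0" "d v0 = 0"
  obtains x v' where "reduction X deg d s x v'" "odd (deg x)"
proof -
  interpret word_complex X deg d s by fact
  obtain m where "m \<in> Poly_Mapping.keys v0" using v0(2) by (metis all_not_in_conv keys_eq_empty)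
  moreover from this obtain x where x: "m = mvar x" "x \<in> X" "odd (deg x)"
    using v0(1) by (auto simp: gens_odd_supp_on supp_on_def)
  ultimately have nz: "Poly_Mapping.lookup v0 (mvar x) \<noteq> 0" by (simp add: in_keys_iff)
  have vL: "v0 \<in> Lam X deg" using v0(1) by (auto simp: gens_odd_def Lam_word_def)
  \<comment> \<open>Scaling gives \<open>gen x\<close> the coefficient 1, so \<open>u\<close> has
    the form \<open>gen x + v'\<close>.\<close>
  define u where "u = qscale (inverse (Poly_Mapping.lookup v0 (mvar x)))
    (keep (basis_bideg X deg (int (deg x)) 1) v0)"
  have kL: "keep (basis_bideg X deg (int (deg x)) 1) v0 \<in> Lam_bideg X deg (int (deg x)) 1"
    using vL unfolding Lam_supp_on Lam_bideg_def by (rule keep_mem) auto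
  then have u: "u \<in> Lam_bideg X deg (int (deg x)) 1"
    unfolding u_def Lam_bideg_def by (rule supp_on_scale)
  have "d (keep (basis_bideg X deg (int (deg x)) 1) v0) = 0"
    using keep_d[OF vL, of "int (deg x) + 1" "1 + s"] v0(3) by simp
  then have du: "d u = 0" unfolding u_def by (simp add: d_scale[OF Lam_bideg_Lam[OF kL]])
  have ux: "Poly_Mapping.lookup u (mvar x) = 1"
    using nz x(2) by (simp add: u_def lookup_qscale lookup_keep basis_bideg_def mvar_basis)
  have "u - gen x \<in> Lam_bideg (X - {x}) deg (int (deg x)) 1"
    unfolding Lam_bideg_def supp_on_lookup
  proof (intro allI impI)
    fix m assume m: "m \<notin> basis_bideg (X - {x}) deg (int (deg x)) 1"
    show "Poly_Mapping.lookup (u - gen x) m = 0"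
    proof (cases "m = mvar x")
      case True then show ?thesis using ux by (simp add: lookup_minus)
    next
      case False
      have "m \<notin> basis_bideg X deg (int (deg x)) 1"
      proof
        assume m': "m \<in> basis_bideg X deg (int (deg x)) 1"
        then have "word_length m = 1" by (simp add: basis_bideg_def)
        then obtain y where "m = mvar y" by (rule word_length_eq_1)
        then show False using m m' False by (auto simp: basis_bideg_def basis_monos_def)
      qed
      then show ?thesis using u False
        by (auto simp: lookup_minus lookup_single when_def Lam_bideg_def supp_on_lookup)
    qed
  qed
  moreover have "d (gmult deg (gen x + (u - gen x)) a) =
      qscale ((- 1) ^ deg x) (gmult deg (gen x + (u - gen x)) (d a))" if "a \<in> Lam X deg" for a
  proof -
    have "u \<in> Lam_deg X deg (deg x)"
      using u unfolding Lam_bideg_def Lam_deg_supp_on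
      by (rule supp_on_mono) (auto simp: basis_bideg_def)
    from d_derivation[OF this that] du show ?thesis by simp
  qed
  ultimately have "reduction X deg d s x (u - gen x)"
    using x by unfold_locales auto
  then show ?thesis using that x(3) by blast
qed

theorem theorem2p5:
  fixes X :: "nat set" and deg :: "nat \<Rightarrow> nat" and d :: "elt \<Rightarrow> elt" and l e :: nat
  assumes "minimal_algebra X deg d"
    and "elliptic X deg d"
    and "2 \<le> l"
    and "homogeneous_length X deg d l"
    and "\<exists>v\<in>gens_odd X deg. v \<noteq> 0 \<and> d v = 0"
    and "e = elt.dim (gens_odd X deg) + (l - 2) * elt.dim (gens_even X deg)"
  shows "toomer X deg d = enat e \<and> (\<forall>k\<in>{1..e - 1}. 2 \<le> dim_cohomology_word X deg d k)"
proof -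
  interpret minimal_algebra X deg d by fact
  obtain s where s: "l = Suc s" "1 \<le> s" using assms(3) by (cases l) auto
  have WC: "word_complex X deg d (int s)"
    using to_word_complex[OF _ s(2) finite_generators[OF assms(2)]] assms(4) s(1) by simp
  obtain x v' where R: "reduction X deg d (int s) x v'" and odd: "odd (deg x)"
    using odd_cocycle_reduction[OF WC] assms(5) by blast
  interpret reduction X deg d "int s" x v' by fact
  obtain M where M: "\<And>i k. coh i k \<Longrightarrow> k \<le> M"
    using coh_bounded assms(2) by (auto simp: elliptic_def)
  let ?e = "\<lambda>X. int (card {x \<in> X. odd (deg x)}) + (int s - 1) * int (card {x \<in> X. even (deg x)})"
  \<comment> \<open>The invariant is applied to the quotient by the odd cocycle, whose cohomology
    inherits the bound \<open>M\<close>.\<close>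
  have g': "gapless quotient.coh (?e (X - {x}))"
    using word_complex_gapless[OF quotient.word_complex_axioms] quotient_bounded[of M] M by blast
  have "{y \<in> X. odd (deg y)} = insert x {y \<in> X - {x}. odd (deg y)}"
      "{y \<in> X - {x}. even (deg y)} = {y \<in> X. even (deg y)}"
    using x_mem odd by auto
  moreover have e: "int e = ?e X"
    using assms(6) s
    by (simp add: gens_odd_supp_on gens_even_supp_on dim_span_gen of_nat_diff)
  ultimately have e': "int e = ?e (X - {x}) + 1" using finite_X by simp
  have "0 \<le> ?e (X - {x})" using s(2) by simp
  then have "1 \<le> e" using e' by linarith
  moreover have "gapless coh (int e)"
    using gapless_reduction[OF g', of M] M odd e' by simp
  ultimately have "toomer X deg d = enat e" by (intro toomer_eq)
  \<comment> \<open>The quotient has maximal word-length \<open>e - 1\<close>, so it has nonzero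
    classes of word-lengths \<open>k\<close> and \<open>k - 1\<close>.\<close>
  moreover have "2 \<le> dim_cohomology_word X deg d k" if "k \<in> {1..e - 1}" for k
    using that e' by (intro dim_cohomology_word_ge_2[OF odd g']) auto
  ultimately show ?thesis by blast
qed

end
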